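(* Let $a,b,c$ be positive integers with $D:=b^2-ac>0$. For generic nonzero complex $x,y$, $$f_{a,b,c}(x,y;q)=g_{a,b,c}(x,y,-1,-1;q)+\frac{1}{\Theta(-1;q^{aD})\,\Theta(-1;q^{cD})}\, \theta_{a,b,c}(x,y;q),$$ where \begin{align*} &\theta_{a,b,c}(x,y;q):= \sum_{d^*=0}^{b-1}\sum_{e^*=0}^{b-1}q^{a\binom{d-c/2}{2}+b( d-c/2 ) (e+a/2 )+c\binom{e+a/2}{2}}(-x)^{d-c/2}(-y)^{e+a/2}\\ &\cdot\sum_{f=0}^{b-1}q^{ab^2\binom{f}{2}+\big (a(bd+b^2+ce)-ac(b+1)/2 \big )f} (-y)^{af} \cdot \Theta\big(-q^{c ( ad+be+a(b-1)/2+abf )}(-x)^{c};q^{cb^2}\big)\\ &\cdot \Theta\big(-q^{a ( (d+b(b+1)/2+bf)(b^2-ac) +c(a-b)/2)}(-x)^{-ac}(-y)^{ab};q^{ab^2D}\big)\\ &\cdot \frac{(q^{bD};q^{bD})_{\infty}^3\,\Theta(q^{ D(d+e)+ac-b(a+c)/2}(-x)^{b-c}(-y)^{b-a};q^{bD})} {\Theta(q^{De+a(c-b)/2}(-x)^b(-y)^{-a};q^{bD})\,\Theta(q^{Dd+c(a-b)/2}(-y)^b(-x)^{-c};q^{bD})}, \end{align*} with $d:=d^*+\{c/2 \}$ and $e:=e^*+\{ a/2\}$, where $0\le \{\alpha \}<1$ denotes the fractional part of $\alpha$.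
   Context: Let $q$ be a complex number with $0<|q|<1$ (fractional powers of $q$ and of $-x,-y$ understood via a consistent choice of branches, e.g. $q=e^{2\pi i\tau}$). Write $(x;q)_\infty=\prod_{i\ge0}(1-xq^i)$, $\Theta(x;q):=(x;q)_\infty(q/x;q)_\infty(q;q)_\infty$, and let $m(x,z;q):=\frac{1}{\Theta(z;q)}\sum_{r\in\mathbb{Z}}\frac{(-1)^rq^{\binom{r}{2}}z^r}{1-q^{r-1}xz}$ (Appell function). Let $\mathrm{sg}(r)=1$ if $r\ge0$ and $-1$ if $r<0$, $\mathrm{sg}(r,s):=(\mathrm{sg}(r)+\mathrm{sg}(s))/2$. The Hecke-type double sum is $$f_{a,b,c}(x,y;q):=\sum_{r,s\in\mathbb{Z}}\mathrm{sg}(r,s) (-1)^{r+s}x^ry^sq^{a\binom{r}{2}+brs+c\binom{s}{2}},$$ and \begin{align*} g_{a,b,c}(x,y,z_1,z_0;q) &:=\sum_{t=0}^{a-1}(-y)^tq^{c\binom{t}{2}}\Theta(q^{bt}x;q^a)\,m\Big (-q^{a\binom{b+1}{2}-c\binom{a+1}{2}-tD}\frac{(-y)^a}{(-x)^b},z_0;q^{aD}\Big ) \\ &\ \ +\sum_{t=0}^{c-1}(-x)^tq^{a\binom{t}{2}}\Theta(q^{bt}y;q^c)\,m\Big (-q^{c\binom{b+1}{2}-a\binom{c+1}{2}-tD}\frac{(-x)^c}{(-y)^b},z_1;q^{cD}\Big ). \end{align*} *)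

theory Defs
  imports "HOL-Analysis.Analysis"
begin

(* The binomial coefficient binom(r, 2) for r an arbitrary integer; the library's generalised
   binomial coefficient gchoose, used further below for real arguments, needs a field. *)
definition choose2 :: "int \<Rightarrow> int" where
  "choose2 r = r * (r - 1) div 2"

definition qpoch_inf :: "complex \<Rightarrow> complex \<Rightarrow> complex" where
  "qpoch_inf x q = (\<Prod>i. 1 - x * q ^ i)"

definition Theta :: "complex \<Rightarrow> complex \<Rightarrow> complex" where
  "Theta x q = qpoch_inf x q * qpoch_inf (q / x) q * qpoch_inf q q"

definition appell_m :: "complex \<Rightarrow> complex \<Rightarrow> complex \<Rightarrow> complex" where
  "appell_m x z q = 1 / Theta z q *
     (\<Sum>\<^sub>\<infinity>r::int. (-1) powi r * q powi choose2 r * z powi r / (1 - q powi (r - 1) * x * z))"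

(* Unlike the library's sgn, sg 0 = 1. *)
definition sg :: "int \<Rightarrow> complex" where
  "sg r = (if r \<ge> 0 then 1 else -1)"

definition sg2 :: "int \<Rightarrow> int \<Rightarrow> complex" where
  "sg2 r s = (sg r + sg s) / 2"

definition hecke_f :: "int \<Rightarrow> int \<Rightarrow> int \<Rightarrow> complex \<Rightarrow> complex \<Rightarrow> complex \<Rightarrow> complex" where
  "hecke_f a b c x y q =
     (\<Sum>\<^sub>\<infinity>(r, s)\<in>UNIV. sg2 r s * (-1) powi (r + s) * x powi r * y powi s *
        q powi (a * choose2 r + b * r * s + c * choose2 s))"

(* The first argument of m in the t-th term of the first sum of g; swapping a with c and
   x with y gives the one in the second sum. *)
definition appell_arg ::
  "int \<Rightarrow> int \<Rightarrow> int \<Rightarrow> complex \<Rightarrow> complex \<Rightarrow> complex \<Rightarrow> int \<Rightarrow> complex" where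
  "appell_arg a b c x y q t =
     - (q powi (a * choose2 (b + 1) - c * choose2 (a + 1) - t * (b\<^sup>2 - a * c)))
       * ((- y) powi a / (- x) powi b)"

definition hecke_g ::
  "int \<Rightarrow> int \<Rightarrow> int \<Rightarrow> complex \<Rightarrow> complex \<Rightarrow> complex \<Rightarrow> complex \<Rightarrow> complex \<Rightarrow> complex" where
  "hecke_g a b c x y z1 z0 q =
     (let D = b\<^sup>2 - a * c in
       (\<Sum>t=0..a - 1. (- y) powi t * q powi (c * choose2 t) *
          Theta (q powi (b * t) * x) (q powi a) *
          appell_m (appell_arg a b c x y q t) z0 (q powi (a * D)))
     + (\<Sum>t=0..c - 1. (- x) powi t * q powi (a * choose2 t) *
          Theta (q powi (b * t) * y) (q powi c) *
          appell_m (appell_arg c b a y x q t) z1 (q powi (c * D))))"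

(* cpow L s is the power w^s of w = exp L, for the branch given by the logarithm L of w.
   Below, Lq, Lx, Ly are logarithms of q, -x and -y. *)
definition cpow :: "complex \<Rightarrow> real \<Rightarrow> complex" where
  "cpow L s = exp (of_real s * L)"

(* The argument of the first theta function in the denominator of the summand of theta_{a,b,c};
   swapping a with c and x with y, and taking d in place of e, gives that of the second one. *)
definition theta_den_arg ::
  "real \<Rightarrow> real \<Rightarrow> real \<Rightarrow> complex \<Rightarrow> complex \<Rightarrow> complex \<Rightarrow> real \<Rightarrow> complex" where
  "theta_den_arg a b c Lq Lx Ly e =
     cpow Lq ((b\<^sup>2 - a * c) * e + a * (c - b) / 2) * cpow Lx b * cpow Ly (- a)"

(* The exponents are written with real copies a, b, c of the integer parameters a', b', c',
   as d and e may be half-integers. *)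
definition hecke_theta ::
  "int \<Rightarrow> int \<Rightarrow> int \<Rightarrow> complex \<Rightarrow> complex \<Rightarrow> complex \<Rightarrow> complex" where
  "hecke_theta a' b' c' Lq Lx Ly =
     (let a = real_of_int a'; b = real_of_int b'; c = real_of_int c'; D = b\<^sup>2 - a * c in
      \<Sum>d'=0..b' - 1. \<Sum>e'=0..b' - 1.
       (let d = real_of_int d' + frac (c / 2); e = real_of_int e' + frac (a / 2) in
        cpow Lq (a * ((d - c / 2) gchoose 2) + b * (d - c / 2) * (e + a / 2)
                 + c * ((e + a / 2) gchoose 2))
        * cpow Lx (d - c / 2) * cpow Ly (e + a / 2)
        * (\<Sum>f'=0..b' - 1.
           (let f = real_of_int f' in
            cpow Lq (a * b\<^sup>2 * (f gchoose 2)
                     + (a * (b * d + b\<^sup>2 + c * e) - a * c * (b + 1) / 2) * f)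
            * cpow Ly (a * f)
            * Theta (- cpow Lq (c * (a * d + b * e + a * (b - 1) / 2 + a * b * f)) * cpow Lx c)
                    (cpow Lq (c * b\<^sup>2))
            * Theta (- cpow Lq (a * ((d + b * (b + 1) / 2 + b * f) * (b\<^sup>2 - a * c)
                                     + c * (a - b) / 2))
                       * cpow Lx (- a * c) * cpow Ly (a * b))
                    (cpow Lq (a * b\<^sup>2 * D))
            * ((qpoch_inf (cpow Lq (b * D)) (cpow Lq (b * D))) ^ 3
               * Theta (cpow Lq (D * (d + e) + a * c - b * (a + c) / 2)
                          * cpow Lx (b - c) * cpow Ly (b - a))
                       (cpow Lq (b * D))
               / (Theta (theta_den_arg a b c Lq Lx Ly e) (cpow Lq (b * D))
                  * Theta (theta_den_arg c b a Lq Ly Lx d) (cpow Lq (b * D))))))))"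

(* Genericity: no term of the Appell functions in g_{a,b,c}(x,y,-1,-1;q) and no theta quotient in
   theta_{a,b,c}(x,y;q) has a vanishing denominator.  The remaining denominators, Theta(-1;q^n) with
   n > 0, do not depend on x and y, and never vanish. *)
definition generic ::
  "int \<Rightarrow> int \<Rightarrow> int \<Rightarrow> complex \<Rightarrow> complex \<Rightarrow> complex \<Rightarrow> complex \<Rightarrow> complex \<Rightarrow> complex \<Rightarrow> bool" where
  "generic a b c x y q Lq Lx Ly \<longleftrightarrow>
     (let D = b\<^sup>2 - a * c in
      (\<forall>t\<in>{0..a - 1}. \<forall>r::int.
         1 - (q powi (a * D)) powi (r - 1) * appell_arg a b c x y q t * (-1) \<noteq> 0) \<and>
      (\<forall>t\<in>{0..c - 1}. \<forall>r::int.
         1 - (q powi (c * D)) powi (r - 1) * appell_arg c b a y x q t * (-1) \<noteq> 0) \<and>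
      (\<forall>e\<in>{0..b - 1}.
         Theta (theta_den_arg a b c Lq Lx Ly (of_int e + frac (of_int a / 2))) (q powi (b * D)) \<noteq> 0) \<and>
      (\<forall>d\<in>{0..b - 1}.
         Theta (theta_den_arg c b a Lq Ly Lx (of_int d + frac (of_int c / 2))) (q powi (b * D)) \<noteq> 0))"

end

theory Submission
  imports Defs
begin

text \<open>Write \<open>F(r,s) = (-x)\<^sup>r (-y)\<^sup>s q\<^bsup>a r(r-1)/2 + b r s + c s(s-1)/2\<^esup>\<close>. After multiplication by
  \<open>Theta (-1) (q\<^bsup>aD\<^esup>) * Theta (-1) (q\<^bsup>cD\<^esup>)\<close> every part of the identity becomes a sum over the lattice of all
  \<open>((r, s), (k, l))\<close> of the same term \<open>G = F(r,s) q\<^bsup>aD k(k-1)/2 + cD l(l-1)/2\<^esup>\<close>, weighted by half the sum of two signs: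
  \<open>sg r + sg s\<close> for \<open>f\<close>, \<open>sg s + \<sigma>\<^sub>1\<close> and \<open>sg r + \<sigma>\<^sub>2\<close> for the two sums of \<open>g\<close> (expand each denominator
  of the Appell functions geometrically), and \<open>- \<sigma>\<^sub>1 - \<sigma>\<^sub>2\<close> for \<open>\<theta>\<close> (expand the theta quotient by Kronecker's
  formula). Here \<open>\<sigma>\<^sub>1\<close> and \<open>\<sigma>\<^sub>2\<close> depend only on \<open>s - a k\<close> and \<open>r - c l\<close>. The weights cancel termwise. The
  expansions converge absolutely unless some geometric ratio has modulus 1; such \<open>x\<close> are reached by
  multiplying \<open>x\<close> by \<open>exp \<epsilon>\<close> and letting \<open>\<epsilon>\<close> tend to 0, since all parts are continuous at generic points.\<close>

section \<open>The Jacobi triple product\<close>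

text \<open>The quadratic form in the exponent of \<open>G\<close> has signature (3,1), and its
  isotropic vectors govern both \<open>g\<close> and \<open>\<theta>\<close>. In the coordinates
  \<open>(r, s, k, l)\<close> two of them are \<open>(b, -a, -1, 0)\<close> and
  \<open>(-c, b, 0, -1)\<close>. Along the first \<open>G\<close> changes geometrically, with a
  ratio depending only on \<open>s - a k\<close>, which stays constant; along the second the same
  holds with \<open>r - c l\<close>. Summing along one of them produces the denominators of the
  Appell functions. The two pair to \<open>b D\<close>, so together they carry a Kronecker sum with
  base \<open>q^(bD)\<close>. Orthogonal to both and to each other are \<open>(c, 0, 0, 1)\<close>
  and \<open>(-ac, ab, b, -a)\<close>, with values \<open>c b^2\<close> and \<open>a b^2 D\<close>:
  these are the bases of the other two theta functions in \<open>\<theta>\<close>. The four vectors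
  span a sublattice of index \<open>b^3\<close>, which is why \<open>\<theta>\<close> has three sums
  over residues modulo \<open>b\<close>.

  Genericity excludes only poles, not ratios of modulus 1 elsewhere on the unit circle; this gap is
  what forces the final limit.\<close>

lemma tendsto_infsum_dominated:
  fixes f :: "'a \<Rightarrow> 'b \<Rightarrow> 'c :: banach"
  assumes lim: "\<And>x. x \<in> X \<Longrightarrow> ((\<lambda>t. f x t) \<longlongrightarrow> g x) F"
    and bound: "eventually (\<lambda>t. \<forall>x\<in>X. norm (f x t) \<le> M x) F"
    and M: "M summable_on X" and F: "F \<noteq> bot"
  shows "((\<lambda>t. \<Sum>\<^sub>\<infinity>x\<in>X. f x t) \<longlongrightarrow> (\<Sum>\<^sub>\<infinity>x\<in>X. g x)) F"
proof -
  define Y where "Y = {t. \<forall>x\<in>X. norm (f x t) \<le> M x}"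
  have gM: "norm (g x) \<le> M x" if "x \<in> X" for x
    using tendsto_upperbound[OF tendsto_norm[OF lim[OF that]] _ F] bound that
    by (smt (verit, best) eventually_mono)
  have "g summable_on X"
    using Infinite_Sum.abs_summable_on_comparison_test'[OF M gM] by (rule abs_summable_summable)
  then have g: "((\<lambda>A. sum g A) \<longlongrightarrow> (\<Sum>\<^sub>\<infinity>x\<in>X. g x)) (finite_subsets_at_top X)"
    using has_sum_def has_sum_infsum by blast
  \<comment> \<open>The M-test makes the finite partial sums converge uniformly in \<open>t\<close>
    on \<open>Y\<close>; this permits exchanging the limit over finite sets with the limit along
    \<open>F\<close>.\<close>
  have u: "uniform_limit Y (\<lambda>A t. \<Sum>x\<in>A. f x t) (\<lambda>t. \<Sum>\<^sub>\<infinity>x\<in>X. f x t) (finite_subsets_at_top X)"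
    by (rule Weierstrass_m_test_general[OF _ M]) (auto simp: Y_def)
  have l: "\<forall>\<^sub>F A in finite_subsets_at_top X. ((\<lambda>t. \<Sum>x\<in>A. f x t) \<longlongrightarrow> sum g A) F"
    by (rule eventually_finite_subsets_at_top_weakI) (auto intro!: tendsto_sum lim)
  show ?thesis
    by (rule swap_uniform_limit'[OF l g u]) (use bound in \<open>auto simp: Y_def\<close>)
qed

lemma summable_on_int_halves:
  fixes f :: "int \<Rightarrow> 'a :: banach"
  assumes "(\<lambda>n::nat. f (int n)) summable_on UNIV" "(\<lambda>n::nat. f (- int n)) summable_on UNIV"
  shows "f summable_on UNIV"
proof -
  have a: "f summable_on {0..}"
  proof -
    have "f summable_on {0..} \<longleftrightarrow> (\<lambda>n::nat. f (int n)) summable_on UNIV"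
      by (rule summable_on_reindex_bij_witness[of _ int nat]) auto
    with assms(1) show ?thesis by simp
  qed
  have b: "f summable_on {..0}"
  proof -
    have "f summable_on {..0} \<longleftrightarrow> (\<lambda>n::nat. f (- int n)) summable_on UNIV"
      by (rule summable_on_reindex_bij_witness[of _ "\<lambda>n. - int n" "\<lambda>n. nat (- n)"]) auto
    with assms(2) show ?thesis by simp
  qed
  have c: "f summable_on {..-1}" by (rule summable_on_subset_banach[OF b]) auto
  have "f summable_on ({0..} \<union> {..-1})" by (rule summable_on_Un_disjoint[OF a c]) auto
  moreover have "{0..} \<union> {..-1} = (UNIV :: int set)" by auto
  ultimately show ?thesis by simp
qed

lemma has_sum_minus:
  fixes f g :: "'a \<Rightarrow> 'b :: real_normed_vector"
  assumes "(f has_sum a) A" "(g has_sum b) A"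
  shows "((\<lambda>x. f x - g x) has_sum (a - b)) A"
  using has_sum_add[OF assms(1), of "\<lambda>x. - g x" "- b"] assms(2) by (simp add: has_sum_uminus)

section \<open>Integer binomials and convergence of theta series\<close>

lemma two_choose2: "2 * choose2 n = n * (n - 1)"
  unfolding choose2_def by (simp add: even_mult_iff)

lemma choose2_add: "choose2 (m + n) = choose2 m + choose2 n + m * n"
  using two_choose2[of "m + n"] two_choose2[of m] two_choose2[of n] by (simp add: algebra_simps)

lemma choose2_0 [simp]: "choose2 0 = 0" and choose2_1 [simp]: "choose2 1 = 0"
  by (simp_all add: choose2_def)

lemma choose2_Suc: "choose2 (1 + n) = choose2 n + n" "choose2 (n + 1) = choose2 n + n"
  by (simp_all add: choose2_add)

lemma choose2_diff_1: "choose2 (n - 1) = choose2 n - n + 1"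
  using choose2_Suc(2)[of "n - 1"] by simp

lemma choose2_uminus: "choose2 (- n) = choose2 n + n"
  using two_choose2[of "- n"] two_choose2[of n] by (simp add: algebra_simps)

lemma theta_half_summable:
  fixes q x :: complex
  assumes q: "0 < norm q" "norm q < 1"
  shows "(\<lambda>n::nat. q powi choose2 (int n) * x ^ n) summable_on UNIV"
proof -
  define f where "f = (\<lambda>n::nat. q powi choose2 (int n) * x ^ n)"
  have q0: "q \<noteq> 0" using q by auto
  have "(\<lambda>n. norm q ^ n * norm x) \<longlonglongrightarrow> 0 * norm x"
    by (intro tendsto_mult tendsto_const LIMSEQ_power_zero) (use q in auto)
  then have "\<forall>\<^sub>F n in sequentially. norm q ^ n * norm x < 1/2"
    by (intro order_tendstoD(2)[where y = "0 * norm x"]) auto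
  then obtain N where N: "\<And>n. n \<ge> N \<Longrightarrow> norm q ^ n * norm x < 1/2"
    by (auto simp: eventually_sequentially)
  have rec: "f (Suc n) = q ^ n * x * f n" for n
    using q0 by (simp add: f_def choose2_Suc power_int_add)
  have "summable (\<lambda>n. norm (f n))"
  proof (rule summable_ratio_test[of "1/2" N])
    fix n assume "N \<le> n"
    have "norm (f (Suc n)) = (norm q ^ n * norm x) * norm (f n)"
      by (simp add: rec norm_mult norm_power)
    also have "\<dots> \<le> 1/2 * norm (f n)"
      using N[OF \<open>N \<le> n\<close>] by (intro mult_right_mono) auto
    finally show "norm (norm (f (Suc n))) \<le> 1/2 * norm (norm (f n))" by simp
  qed auto
  then show ?thesis
    unfolding f_def by (rule norm_summable_imp_summable_on)
qed

lemma theta_summable: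
  fixes q x :: complex
  assumes q: "0 < norm q" "norm q < 1" and x: "x \<noteq> 0"
  shows "(\<lambda>n::int. q powi choose2 n * x powi n) summable_on UNIV"
proof (rule summable_on_int_halves)
  have q0: "q \<noteq> 0" using q by auto
  show "(\<lambda>n::nat. q powi choose2 (int n) * x powi int n) summable_on UNIV"
    using theta_half_summable[OF q] by simp
  have "(\<lambda>n::nat. q powi choose2 (int n) * (q / x) ^ n) summable_on UNIV"
    by (rule theta_half_summable[OF q])
  moreover have "q powi choose2 (int n) * (q / x) ^ n = q powi choose2 (- int n) * x powi (- int n)" for n
    using q0 x by (simp add: choose2_uminus power_int_add power_int_minus field_simps power_divide)
  ultimately show "(\<lambda>n::nat. q powi choose2 (- int n) * x powi (- int n)) summable_on UNIV"
    by simp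
qed

lemma power_Suc_ne_1:
  fixes q :: complex
  assumes "norm q < 1"
  shows "q ^ Suc n \<noteq> 1"
proof
  assume "q ^ Suc n = 1"
  then have "norm q ^ Suc n = 1" by (metis norm_one norm_power)
  then show False using power_Suc_le_self[of "norm q" n] assms by simp
qed

section \<open>Infinite q-products and the triple product\<close>

lemma qpoch_convergent:
  fixes q x :: complex
  assumes "norm q < 1"
  shows "convergent_prod (\<lambda>i. 1 - x * q ^ i)"
proof -
  have "summable (\<lambda>i. norm ((1 - x * q ^ i) - 1))"
    using assms by (simp add: norm_mult norm_power summable_mult summable_geometric)
  then show ?thesis
    by (intro abs_convergent_prod_imp_convergent_prod)
       (simp add: abs_convergent_prod_conv_summable)
qed

lemma qpoch_lim:
  assumes "norm q < 1"
  shows "(\<lambda>N. \<Prod>i<N. 1 - x * q ^ i) \<longlonglongrightarrow> qpoch_inf x q"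
proof -
  have "(\<lambda>N. \<Prod>i\<le>N. 1 - x * q ^ i) \<longlonglongrightarrow> qpoch_inf x q"
    unfolding qpoch_inf_def by (rule convergent_prod_LIMSEQ[OF qpoch_convergent[OF assms]])
  then show ?thesis by (simp add: LIMSEQ_lessThan_iff_atMost)
qed

lemma qpoch_eq_0_iff:
  assumes "norm q < 1"
  shows "qpoch_inf x q = 0 \<longleftrightarrow> (\<exists>i. x * q ^ i = 1)"
proof -
  have "(\<lambda>i. 1 - x * q ^ i) has_prod qpoch_inf x q"
    unfolding qpoch_inf_def by (rule convergent_prod_has_prod[OF qpoch_convergent[OF assms]])
  from has_prod_eq_0_iff[OF this] show ?thesis by auto
qed

lemma qpoch_Suc:
  assumes "norm q < 1"
  shows "qpoch_inf x q = (1 - x) * qpoch_inf (q * x) q"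
proof -
  have "(\<lambda>N. \<Prod>i<Suc N. 1 - x * q ^ i) \<longlonglongrightarrow> qpoch_inf x q"
    using qpoch_lim[OF assms] by (rule LIMSEQ_Suc)
  moreover have "(\<Prod>i<Suc N. 1 - x * q ^ i) = (1 - x) * (\<Prod>i<N. 1 - (q * x) * q ^ i)" for N
    unfolding prod.lessThan_Suc_shift by (simp add: mult_ac)
  moreover have "(\<lambda>N. (1 - x) * (\<Prod>i<N. 1 - (q * x) * q ^ i)) \<longlonglongrightarrow> (1 - x) * qpoch_inf (q * x) q"
    by (intro tendsto_mult tendsto_const qpoch_lim assms)
  ultimately show ?thesis using LIMSEQ_unique by auto
qed

text \<open>Cauchy's finite form of the triple product. \<open>h\<close> is the reciprocal of a
  finite q-factorial, set to 0 at negative indices, so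
  \<open>Q (2 * N) * h (N - n) * h (N + n)\<close> is the Gaussian binomial coefficient of
  \<open>2 N\<close> over \<open>N + n\<close> and vanishes for \<open>n\<close> outside
  \<open>{-N..N}\<close>. The finite sum can thus be written over all integers, and the index shifts
  of the induction leave no boundary terms.\<close>

lemma jacobi_triple_finite:
  fixes q x :: complex
  assumes q: "0 < norm q" "norm q < 1" and x: "x \<noteq> 0"
  defines "Q \<equiv> \<lambda>n. \<Prod>i<n. 1 - q * q ^ i"
  defines "h \<equiv> \<lambda>k::int. if k < 0 then 0 else 1 / Q (nat k)"
  shows "((\<lambda>n. (-1) powi n * q powi choose2 n * x powi n * (Q (2 * N) * h (int N - n) * h (int N + n)))
           has_sum (\<Prod>i<N. 1 - x * q ^ i) * (\<Prod>i<N. 1 - q / x * q ^ i)) UNIV"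
proof (induction N)
  case 0
  show ?case
    by (rule has_sum_finite_neutralI[of "{0}"]) (auto simp: h_def Q_def)
next
  case (Suc N)
  have q0: "q \<noteq> 0" using q by auto
  note q1 = power_Suc_ne_1[OF q(2)]
  \<comment> \<open>The zero convention is consistent with the recurrence: at \<open>k = 0\<close>
    both sides vanish because \<open>1 - q powi 0 = 0\<close>.\<close>
  have h_rec: "h (k - 1) = h k * (1 - q powi k)" for k
  proof (cases "k \<ge> 1")
    case True
    define m where "m = nat (k - 1)"
    have k: "k = int (Suc m)" using True by (simp add: m_def)
    have "Q (Suc m) = Q m * (1 - q powi k)" by (simp add: Q_def k power_int_add q0)
    moreover have "1 - q powi k \<noteq> 0" using q1[of m] by (simp add: k power_int_add q0)
    ultimately show ?thesis using k by (simp add: h_def nat_add_distrib)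
  next
    case False
    then show ?thesis by (cases "k = 0") (auto simp: h_def)
  qed
  define P where "P = (\<Prod>i<N. 1 - x * q ^ i) * (\<Prod>i<N. 1 - q / x * q ^ i)"
  define c where "c = (\<lambda>N n. Q (2 * N) * h (int N - n) * h (int N + n))"
  define t where "t = (\<lambda>n::int. (-1) powi n * q powi choose2 n * x powi n)"
  have t_up: "t (n - 1) * (x * q powi (n - 1)) = - t n" for n
    using x q0 by (simp add: t_def choose2_diff_1 power_int_diff power_int_add field_simps)
  have t_down: "t (n + 1) = - t n * (x * q powi n)" for n
    using x q0 by (simp add: t_def choose2_Suc power_int_add field_simps)
  have IH: "((\<lambda>n. t n * c N n) has_sum P) UNIV"
    using Suc.IH by (simp add: t_def c_def P_def)
  have s1: "((\<lambda>n. t (n - 1) * c N (n - 1)) has_sum P) UNIV"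
    using IH by (subst has_sum_reindex_bij_witness[of _ "\<lambda>n. n + 1" "\<lambda>n. n - 1" UNIV]) auto
  have s2: "((\<lambda>n. t (n + 1) * c N (n + 1)) has_sum P) UNIV"
    using IH by (subst has_sum_reindex_bij_witness[of _ "\<lambda>n. n - 1" "\<lambda>n. n + 1" UNIV]) auto
  \<comment> \<open>The factors new at \<open>Suc N\<close> multiply to
    \<open>1 + q^(2N+1) - x q^N - q^(N+1)/x\<close>. Combining the shifted sums with these
    coefficients leaves, for each fixed \<open>n\<close>, a recurrence between Gaussian
    binomials.\<close>
  have "((\<lambda>n. (1 + q ^ (2 * N + 1)) * (t n * c N n) - x * q ^ N * (t (n - 1) * c N (n - 1))
           - q ^ (N + 1) / x * (t (n + 1) * c N (n + 1))) has_sum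
         ((1 + q ^ (2 * N + 1)) * P - x * q ^ N * P - q ^ (N + 1) / x * P)) UNIV"
    by (intro has_sum_minus has_sum_cmult_right IH s1 s2)
  moreover have "(1 + q ^ (2 * N + 1)) * P - x * q ^ N * P - q ^ (N + 1) / x * P
      = (\<Prod>i<Suc N. 1 - x * q ^ i) * (\<Prod>i<Suc N. 1 - q / x * q ^ i)"
    using x by (simp add: P_def field_simps power_add mult_2 power_mult power2_eq_square)
  moreover have "(1 + q ^ (2 * N + 1)) * (t n * c N n) - x * q ^ N * (t (n - 1) * c N (n - 1))
           - q ^ (N + 1) / x * (t (n + 1) * c N (n + 1)) = t n * c (Suc N) n" for n
  proof -
    define A where "A = h (int (Suc N) - n)"
    define B where "B = h (int (Suc N) + n)"
    define u where "u = q powi (int N - n)"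
    define v where "v = q powi (int N + n)"
    have uv: "q ^ (2 * N) = u * v"
      using q0 by (simp add: u_def v_def power_int_add power_int_diff power_mult power2_eq_square mult_2 power_add)
    have "h (int N - n) = A * (1 - q * u)" "h (int N + n) = B * (1 - q * v)"
      using h_rec[of "int (Suc N) - n"] h_rec[of "int (Suc N) + n"] q0
      by (simp_all add: A_def B_def u_def v_def power_int_add power_int_diff algebra_simps)
    moreover have "h (int N - n - 1) = h (int N - n) * (1 - u)" "h (int N + n - 1) = h (int N + n) * (1 - v)"
      using h_rec[of "int N - n"] h_rec[of "int N + n"] by (simp_all only: u_def v_def)
    moreover have "int N - (n + 1) = int N - n - 1" "int N + (n - 1) = int N + n - 1"
      "int N - (n - 1) = int (Suc N) - n" "int N + (n + 1) = int (Suc N) + n" by simp_all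
    ultimately have hs: "h (int N - n) = A * (1 - q * u)" "h (int N + n) = B * (1 - q * v)"
      "h (int N - (n + 1)) = A * (1 - q * u) * (1 - u)" "h (int N + (n - 1)) = B * (1 - q * v) * (1 - v)"
      "h (int N - (n - 1)) = A" "h (int N + (n + 1)) = B"
      by (simp_all only: A_def B_def)
    have "Q (2 * Suc N) = Q (2 * N) * (1 - q * (u * v)) * (1 - q * (q * (u * v)))"
      by (simp add: Q_def flip: uv)
    then have c1: "c (Suc N) n = Q (2 * N) * (1 - q * (u * v)) * (1 - q * (q * (u * v))) * A * B"
      by (simp add: c_def A_def B_def)
    have t1: "x * q ^ N * t (n - 1) = - q * u * t n"
    proof -
      have "q ^ N = q * u * q powi (n - 1)"
        using q0 by (simp add: u_def power_int_diff)
      then have "x * q ^ N * t (n - 1) = q * u * (t (n - 1) * (x * q powi (n - 1)))"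
        by simp
      then show ?thesis by (simp add: t_up)
    qed
    have t2: "q ^ (N + 1) / x * t (n + 1) = - q * v * t n"
      using x q0 by (simp add: t_down v_def power_int_add)
    have "(1 + q ^ (2 * N + 1)) * (t n * c N n) - x * q ^ N * (t (n - 1) * c N (n - 1))
           - q ^ (N + 1) / x * (t (n + 1) * c N (n + 1))
        = (1 + q * (q ^ (2 * N))) * (t n * c N n) - x * q ^ N * t (n - 1) * c N (n - 1)
           - q ^ (N + 1) / x * t (n + 1) * c N (n + 1)"
      by simp
    also have "\<dots> = t n * c (Suc N) n"
      unfolding t1 t2 c1 uv by (simp add: c_def hs) algebra
    finally show ?thesis .
  qed
  ultimately show ?case by (simp add: t_def c_def)
qed

text \<open>In the finite form each Gaussian binomial tends to \<open>1 / L\<close> with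
  \<open>L = qpoch_inf q q\<close>, and multiplying by \<open>L\<close> supplies the third factor of
  \<open>Theta\<close>. Boundedness of \<open>Q\<close> and of \<open>1 / Q\<close> gives the
  majorant for dominated convergence.\<close>

lemma jacobi_triple:
  fixes q x :: complex
  assumes q: "0 < norm q" "norm q < 1" and x: "x \<noteq> 0"
  shows "((\<lambda>n. (-1) powi n * q powi choose2 n * x powi n) has_sum Theta x q) UNIV"
proof -
  define Q where "Q = (\<lambda>n. \<Prod>i<n. 1 - q * q ^ i)"
  define h where "h = (\<lambda>k::int. if k < 0 then 0 else 1 / Q (nat k))"
  define t where "t = (\<lambda>n::int. (-1) powi n * q powi choose2 n * x powi n)"
  define L where "L = qpoch_inf q q"
  define R where "R = qpoch_inf x q * qpoch_inf (q / x) q"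
  note q1 = power_Suc_ne_1[OF q(2)]
  have L0: "L \<noteq> 0" using q1 q by (auto simp: L_def qpoch_eq_0_iff)
  have Q_lim: "Q \<longlonglongrightarrow> L" unfolding Q_def L_def by (rule qpoch_lim[OF q(2)])
  then have "(\<lambda>n. 1 / Q n) \<longlonglongrightarrow> 1 / L" by (intro tendsto_divide tendsto_const L0)
  then have "Bseq (\<lambda>n. 1 / Q n)" by (rule convergent_imp_Bseq[OF convergentI])
  then obtain C where C: "C > 0" "\<And>n. norm (1 / Q n) \<le> C" by (auto simp: Bseq_def)
  then have hC: "norm (h k) \<le> C" for k using C(2)[of "nat k"] C(1) by (auto simp: h_def)
  have "Bseq Q" using Q_lim by (rule convergent_imp_Bseq[OF convergentI])
  then obtain C' where C': "C' > 0" "\<And>n. norm (Q n) \<le> C'" by (auto simp: Bseq_def)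
  have h_lim: "(\<lambda>N. h (int N + k)) \<longlonglongrightarrow> 1 / L" for k
  proof -
    have "filterlim (\<lambda>N. nat (int N + k)) sequentially sequentially"
      unfolding filterlim_at_top
    proof
      fix Z show "\<forall>\<^sub>F N in sequentially. Z \<le> nat (int N + k)"
        using eventually_ge_at_top[of "nat (int Z - k)"] by eventually_elim auto
    qed
    then have "(\<lambda>N. 1 / Q (nat (int N + k))) \<longlonglongrightarrow> 1 / L"
      using \<open>(\<lambda>n. 1 / Q n) \<longlonglongrightarrow> 1 / L\<close> filterlim_compose by blast
    moreover have "\<forall>\<^sub>F N in sequentially. 1 / Q (nat (int N + k)) = h (int N + k)"
      using eventually_ge_at_top[of "nat (- k)"] by eventually_elim (auto simp: h_def)
    ultimately show ?thesis by (rule Lim_transform_eventually)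
  qed
  have h_lim': "(\<lambda>N. h (int N - k)) \<longlonglongrightarrow> 1 / L" for k using h_lim[of "- k"] by simp
  have Q2: "(\<lambda>N. Q (2 * N)) \<longlonglongrightarrow> L"
    using LIMSEQ_subseq_LIMSEQ[OF Q_lim, of "\<lambda>N. 2 * N"] by (simp add: strict_mono_def comp_def)
  have sm: "t summable_on UNIV"
  proof -
    have "(\<lambda>n. q powi choose2 n * (- x) powi n) summable_on UNIV"
      using theta_summable[OF q, of "- x"] x by simp
    moreover have "q powi choose2 n * (- x) powi n = t n" for n
      using power_int_mult_distrib[of "-1" x n] by (simp add: t_def)
    ultimately show ?thesis by simp
  qed
  have "(\<lambda>N. \<Sum>\<^sub>\<infinity>n. t n * (Q (2 * N) * h (int N - n) * h (int N + n))) \<longlonglongrightarrow> (\<Sum>\<^sub>\<infinity>n. t n * (L * (1 / L) * (1 / L)))"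
  proof (rule tendsto_infsum_dominated[where M = "\<lambda>n. norm (t n) * (C' * C * C)"])
    show "\<forall>\<^sub>F N in sequentially. \<forall>n\<in>UNIV. norm (t n * (Q (2 * N) * h (int N - n) * h (int N + n))) \<le> norm (t n) * (C' * C * C)"
      by (intro always_eventually allI ballI)
         (simp only: norm_mult, intro mult_mono mult_nonneg_nonneg hC C' norm_ge_zero less_imp_le[OF C(1)] less_imp_le[OF C'(1)] order_refl)
    show "(\<lambda>n. norm (t n) * (C' * C * C)) summable_on UNIV"
      using sm by (intro summable_on_cmult_left) (simp add: summable_on_iff_abs_summable_on_complex)
  qed (intro tendsto_intros h_lim h_lim' Q2 | simp)+
  moreover have "(\<lambda>N. \<Sum>\<^sub>\<infinity>n. t n * (Q (2 * N) * h (int N - n) * h (int N + n)))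
      = (\<lambda>N. (\<Prod>i<N. 1 - x * q ^ i) * (\<Prod>i<N. 1 - q / x * q ^ i))"
    using jacobi_triple_finite[OF q x] unfolding t_def h_def Q_def by (intro ext infsumI)
  moreover have "(\<lambda>N. (\<Prod>i<N. 1 - x * q ^ i) * (\<Prod>i<N. 1 - q / x * q ^ i)) \<longlonglongrightarrow> R"
    unfolding R_def by (intro tendsto_mult qpoch_lim q)
  ultimately have "(\<Sum>\<^sub>\<infinity>n. t n * (1 / L)) = R"
    using L0 LIMSEQ_unique by auto
  moreover have "(\<Sum>\<^sub>\<infinity>n. t n * (1 / L)) = infsum t UNIV * (1 / L)"
    by (rule infsum_cmult_left) (use sm in auto)
  ultimately have "infsum t UNIV = R * L"
    using L0 by (simp add: field_simps)
  then show ?thesis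
    using has_sum_infsum[OF sm] by (simp add: t_def R_def L_def Theta_def)
qed

section \<open>Theta functions and geometric expansions\<close>

lemma theta_series:
  fixes q x :: complex
  assumes "0 < norm q" "norm q < 1" "x \<noteq> 0"
  shows "((\<lambda>n. q powi choose2 n * x powi n) has_sum Theta (- x) q) UNIV"
proof -
  have "((\<lambda>n. (-1) powi n * q powi choose2 n * (- x) powi n) has_sum Theta (- x) q) UNIV"
    using jacobi_triple[OF assms(1,2), of "- x"] assms(3) by simp
  moreover have "(-1) powi n * q powi choose2 n * (- x) powi n = q powi choose2 n * x powi n" for n
    using power_int_mult_distrib[of "-1" "-x" n] by simp
  ultimately show ?thesis by simp
qed

lemma Theta_shift:
  assumes "0 < norm q" "norm q < 1" "x \<noteq> 0"
  shows "Theta (q * x) q = - Theta x q / x"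
proof -
  have "Theta (q * x) q = qpoch_inf (q * x) q * ((1 - 1 / x) * qpoch_inf (q / x) q) * qpoch_inf q q"
    using assms qpoch_Suc[OF assms(2), of "1 / x"] by (auto simp: Theta_def)
  also have "\<dots> = - ((1 - x) * qpoch_inf (q * x) q * qpoch_inf (q / x) q * qpoch_inf q q) / x"
    using assms(3) by (simp add: field_simps)
  also have "\<dots> = - Theta x q / x"
    using qpoch_Suc[OF assms(2), of x] by (simp add: Theta_def)
  finally show ?thesis .
qed

lemma Theta_shift_powi:
  assumes "0 < norm q" "norm q < 1" "x \<noteq> 0"
  shows "Theta (q powi k * x) q = (-1) powi k * q powi (- choose2 k) * x powi (- k) * Theta x q"
proof -
  have q0: "q \<noteq> 0" using assms by auto
  have step: "Theta (q powi (k + 1) * x) q = - Theta (q powi k * x) q / (q powi k * x)" for k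
    using Theta_shift[OF assms(1,2), of "q powi k * x"] assms(3) q0 by (simp add: power_int_add mult_ac)
  show ?thesis
  proof (induction k rule: int_induct[where k = 0])
    case base
    then show ?case by simp
  next
    case (step1 i)
    show ?case unfolding step step1(2) using assms q0
      by (simp add: choose2_Suc power_int_add power_int_minus power_int_diff field_simps)
  next
    case (step2 i)
    have "Theta (q powi (i - 1) * x) q = - (q powi (i - 1) * x) * Theta (q powi i * x) q"
      using assms q0 step[of "i - 1"] by (simp add: field_simps)
    then show ?case unfolding step2(2) using assms q0
      by (simp add: choose2_diff_1 power_int_add power_int_minus power_int_diff field_simps)
  qed
qed

lemma Theta_eq_0_iff:
  assumes "0 < norm q" "norm q < 1" "x \<noteq> 0"
  shows "Theta x q = 0 \<longleftrightarrow> (\<exists>k::int. x = q powi k)"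
proof -
  have q0: "q \<noteq> 0" using assms by auto
  note q1 = power_Suc_ne_1[OF assms(2)]
  have "Theta x q = 0 \<longleftrightarrow> (\<exists>i. x * q ^ i = 1) \<or> (\<exists>i. q / x * q ^ i = 1)"
    using q1 assms(2) by (auto simp: Theta_def qpoch_eq_0_iff)
  also have "(\<exists>i. x * q ^ i = 1) \<longleftrightarrow> (\<exists>i::nat. x = q powi (- int i))"
    using q0 by (simp add: power_int_minus field_simps)
  also have "(\<exists>i. q / x * q ^ i = 1) \<longleftrightarrow> (\<exists>i::nat. x = q powi (int i + 1))"
    using q0 assms(3) by (auto simp: power_int_add field_simps)
  also have "(\<exists>i::nat. x = q powi (- int i)) \<or> (\<exists>i::nat. x = q powi (int i + 1)) \<longleftrightarrow> (\<exists>k::int. x = q powi k)"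
  proof (intro iffI)
    assume "\<exists>k::int. x = q powi k"
    then obtain k where k: "x = q powi k" ..
    show "(\<exists>i::nat. x = q powi (- int i)) \<or> (\<exists>i::nat. x = q powi (int i + 1))"
    proof (cases "k \<le> 0")
      case True
      then show ?thesis using k by (intro disjI1 exI[of _ "nat (- k)"]) simp
    next
      case False
      then show ?thesis using k by (intro disjI2 exI[of _ "nat (k - 1)"]) simp
    qed
  qed blast
  finally show ?thesis .
qed

lemma powi_less_1:
  fixes r :: real
  assumes "0 < r" "r < 1"
  shows "r powi k < 1 \<longleftrightarrow> k > 0"
  using power_int_strict_decreasing[of 0 k r] power_int_decreasing[of k 0 r] assms by fastforce

lemma powi_eq_1:
  fixes r :: real
  assumes "0 < r" "r < 1" "r powi k = 1"
  shows "k = 0"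
  using powi_less_1[OF assms(1,2), of k] powi_less_1[OF assms(1,2), of "- k"] assms(3)
  by (auto simp: power_int_minus)

lemma Theta_minus_1_nonzero:
  assumes "0 < norm q" "norm q < 1"
  shows "Theta (-1) q \<noteq> 0"
proof
  assume "Theta (-1) q = 0"
  then obtain k where k: "-1 = q powi k" using Theta_eq_0_iff[OF assms, of "-1"] by auto
  then have "norm q powi k = 1" by (metis norm_minus_cancel norm_one norm_power_int)
  then have "k = 0" using assms powi_eq_1 by blast
  then show False using k by simp
qed

lemma isCont_qpoch:
  fixes q x :: complex
  assumes "norm q < 1"
  shows "isCont (\<lambda>x. qpoch_inf x q) x"
proof -
  define A where "A = cball (0::complex) (norm x + 1)"
  have "uniformly_convergent_on A (\<lambda>N x. \<Prod>n<N. 1 - x * q ^ n)"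
  proof (rule uniformly_convergent_on_prod')
    show "uniformly_convergent_on A (\<lambda>N y. \<Sum>n<N. norm (1 - y * q ^ n - 1))"
    proof (rule Weierstrass_m_test')
      fix n y assume "y \<in> A"
      then show "norm (norm (1 - y * q ^ n - 1)) \<le> (norm x + 1) * norm q ^ n"
        by (auto simp: A_def norm_mult norm_power intro!: mult_right_mono)
    qed (use assms in \<open>auto intro!: summable_mult summable_geometric\<close>)
  qed (auto simp: A_def intro!: continuous_intros)
  then obtain l where l: "uniform_limit A (\<lambda>N x. \<Prod>n<N. 1 - x * q ^ n) l sequentially"
    by (auto simp: uniformly_convergent_on_def)
  have "continuous_on A l"
    by (rule uniform_limit_theorem[OF _ l]) (auto intro!: always_eventually continuous_intros)
  moreover have "l y = qpoch_inf y q" if "y \<in> A" for y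
    using tendsto_uniform_limitI[OF l that] qpoch_lim[OF assms] LIMSEQ_unique by blast
  ultimately have "continuous_on A (\<lambda>x. qpoch_inf x q)"
    by (simp cong: continuous_on_cong)
  then show ?thesis
    by (rule continuous_on_interior) (auto simp: A_def interior_cball)
qed

lemma isCont_Theta:
  fixes q x :: complex
  assumes "norm q < 1" "x \<noteq> 0"
  shows "isCont (\<lambda>x. Theta x q) x"
proof -
  have "isCont (\<lambda>x. qpoch_inf (q / x) q) x"
    by (rule isCont_o2[OF _ isCont_qpoch[OF assms(1)]]) (use assms in \<open>auto intro!: continuous_intros\<close>)
  then show ?thesis
    unfolding Theta_def using isCont_qpoch[OF assms(1)] by (auto intro!: continuous_intros)
qed

text \<open>The sign of \<open>- ln (norm w)\<close>: it selects which of the two geometric expansions of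
  \<open>1 / (1 - w)\<close> converges.\<close>
definition sw :: "complex \<Rightarrow> complex" where
  "sw w = (if norm w < 1 then 1 else -1)"

text \<open>The weight \<open>(sg n + sw w) / 2\<close> is 1 on \<open>n \<ge> 0\<close> and 0
  elsewhere if \<open>norm w < 1\<close>, and it is -1 on \<open>n < 0\<close> and 0 elsewhere if
  \<open>norm w > 1\<close>. One formula thus covers the expansions in \<open>w\<close> and in
  \<open>1 / w\<close>, with a weight that is half a sum of two signs.\<close>

lemma geometric_has_sum:
  assumes "norm w \<noteq> 1" "w \<noteq> 0"
  shows "((\<lambda>n. (sg n + sw w) / 2 * w powi n) has_sum 1 / (1 - w)) UNIV"
proof (cases "norm w < 1")
  case True
  then have "((\<lambda>n. w ^ n) has_sum 1 / (1 - w)) UNIV"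
    using geometric_sums[of w] by (intro norm_summable_imp_has_sum) (auto simp: norm_power summable_geometric)
  also have "?this \<longleftrightarrow> ((\<lambda>n. w powi n) has_sum 1 / (1 - w)) {0::int..}"
    by (rule has_sum_reindex_bij_witness[of _ nat int]) auto
  also have "\<dots> \<longleftrightarrow> ((\<lambda>n. (sg n + sw w) / 2 * w powi n) has_sum 1 / (1 - w)) UNIV"
    by (rule has_sum_cong_neutral) (use True in \<open>auto simp: sg_def sw_def\<close>)
  finally show ?thesis .
next
  case False
  then have gt: "norm w > 1" using assms by auto
  then have w1: "w \<noteq> 1" by auto
  have "((\<lambda>n. (1/w) ^ n) has_sum (1/w / (1 - 1/w))) {1..}"
    by (rule has_sum_geometric_from_1) (use gt in \<open>simp add: norm_divide less_divide_eq_1 divide_less_eq_1\<close>)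
  then have "((\<lambda>n. - ((1/w) ^ n)) has_sum - (1/w / (1 - 1/w))) {1..}"
    by (simp add: has_sum_uminus)
  also have "- (1/w / (1 - 1/w)) = 1 / (1 - w)"
    using assms w1 by (simp add: divide_simps)
  also have "((\<lambda>n. - ((1/w) ^ n)) has_sum 1 / (1 - w)) {1..} \<longleftrightarrow> ((\<lambda>n. - (w powi n)) has_sum 1 / (1 - w)) {..-1::int}"
    by (rule has_sum_reindex_bij_witness[of _ "\<lambda>n. nat (- n)" "\<lambda>n. - int n"])
       (auto simp: power_int_minus power_divide field_simps)
  also have "\<dots> \<longleftrightarrow> ((\<lambda>n. (sg n + sw w) / 2 * w powi n) has_sum 1 / (1 - w)) UNIV"
    by (rule has_sum_cong_neutral) (use gt in \<open>auto simp: sg_def sw_def\<close>)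
  finally show ?thesis .
qed

lemma geometric_norm_has_sum:
  assumes "norm w \<noteq> 1" "w \<noteq> 0"
  shows "((\<lambda>n. norm ((sg n + sw w) / 2 * w powi n)) has_sum 1 / \<bar>1 - norm w\<bar>) UNIV"
proof -
  define v where "v = complex_of_real (norm w)"
  have sv: "sw v = sw w" by (simp add: sw_def v_def)
  \<comment> \<open>All nonzero weights equal \<open>sw w\<close>, so multiplying by it turns the
    series at the positive real number \<open>norm w\<close> into the series of norms.\<close>
  have "((\<lambda>n. sw w * ((sg n + sw v) / 2 * v powi n)) has_sum sw w * (1 / (1 - v))) UNIV"
    by (intro has_sum_cmult_right geometric_has_sum) (use assms in \<open>auto simp: v_def\<close>)
  from has_sum_Re[OF this]
  have "((\<lambda>n. Re (sw w * ((sg n + sw w) / 2 * v powi n))) has_sum Re (sw w * (1 / (1 - v)))) UNIV"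
    by (simp add: sv)
  moreover have "Re (sw w * (1 / (1 - v))) = 1 / \<bar>1 - norm w\<bar>"
  proof -
    have "sw w * (1 / (1 - v)) = complex_of_real (1 / \<bar>1 - norm w\<bar>)"
      using assms by (auto simp: sw_def v_def abs_if field_simps)
    then show ?thesis by (metis Re_complex_of_real)
  qed
  moreover have "Re (sw w * ((sg n + sw w) / 2 * v powi n)) = norm ((sg n + sw w) / 2 * w powi n)" for n
  proof -
    have "sw w * ((sg n + sw w) / 2 * v powi n) = complex_of_real (norm ((sg n + sw w) / 2 * w powi n))"
      by (auto simp: sw_def sg_def v_def norm_mult norm_power_int)
    then show ?thesis by (metis Re_complex_of_real)
  qed
  ultimately show ?thesis by (simp only:)
qed

section \<open>The Kronecker double sum\<close>

lemma has_sum_prod_mult: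
  fixes f :: "'a \<Rightarrow> complex" and g :: "'b \<Rightarrow> complex"
  assumes "(f has_sum a) A" "(g has_sum b) B"
  shows "((\<lambda>(x, y). f x * g y) has_sum a * b) (A \<times> B)"
proof (rule has_sum_SigmaI)
  show "((\<lambda>y. case (x, y) of (x, y) \<Rightarrow> f x * g y) has_sum f x * b) B" for x
    using has_sum_cmult_right[OF assms(2)] by simp
  show "((\<lambda>x. f x * b) has_sum a * b) A"
    using has_sum_cmult_left[OF assms(1)] by simp
  have "(\<lambda>x. norm (f x)) summable_on A" "(\<lambda>x. norm (g x)) summable_on B"
    using assms by (auto simp: summable_on_iff_abs_summable_on_complex dest!: has_sum_imp_summable)
  then have "(\<lambda>(x, y). norm (f x) * norm (g y)) summable_on A \<times> B"
    by (intro summable_on_SigmaI[where g = "\<lambda>x. norm (f x) * (\<Sum>\<^sub>\<infinity>y\<in>B. norm (g y))"])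
       (auto intro!: has_sum_cmult_right has_sum_infsum summable_on_cmult_left)
  then show "(\<lambda>(x, y). f x * g y) summable_on A \<times> B"
    by (simp add: summable_on_iff_abs_summable_on_complex norm_mult case_prod_unfold)
qed

lemma summable_on_prodI:
  fixes f :: "'a \<times> 'b \<Rightarrow> complex"
  assumes "\<And>x. x \<in> A \<Longrightarrow> ((\<lambda>y. norm (f (x, y))) has_sum g x) B" "g summable_on A"
  shows "f summable_on A \<times> B"
proof -
  have "(\<lambda>p. norm (f p)) summable_on A \<times> B"
    by (rule summable_on_SigmaI[where g = g]) (use assms in auto)
  then show ?thesis by (simp add: summable_on_iff_abs_summable_on_complex)
qed

section \<open>Estimates on the fundamental annulus \<open>norm q < norm x < 1\<close>\<close>

lemma annulus_shift:
  fixes q x :: complex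
  assumes "norm q < norm x" "norm x < 1" "0 < norm q"
  shows "if n \<ge> 0 then norm (q powi n * x) < 1 else norm (q powi n * x) > 1"
proof (cases "n \<ge> 0")
  case True
  have "norm q powi n \<le> 1"
    using power_int_decreasing[of 0 n "norm q"] assms True by auto
  then have "norm (q powi n * x) \<le> norm x"
    by (simp add: norm_mult norm_power_int mult_left_le_one_le)
  then show ?thesis using True assms by simp
next
  case False
  have "norm q powi (-1) \<le> norm q powi n"
    using power_int_decreasing[of n "-1" "norm q"] assms False by auto
  then have "norm q powi (-1) * norm x \<le> norm (q powi n * x)"
    by (simp add: norm_mult norm_power_int mult_right_mono)
  moreover have "norm q powi (-1) * norm x > 1" using assms by (simp add: power_int_minus field_simps)
  ultimately show ?thesis using False by simp
qed

lemma sw_annulus: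
  assumes "norm q < norm x" "norm x < 1" "0 < norm q"
  shows "sw (q powi n * x) = sg n"
  using annulus_shift[OF assms, of n] by (auto simp: sw_def sg_def split: if_splits)

lemma annulus_ne_1:
  fixes q x :: complex
  assumes "norm q < norm x" "norm x < 1" "0 < norm q"
  shows "norm (q powi n * x) \<noteq> 1"
  using annulus_shift[OF assms, of n] by (auto split: if_splits)

lemma annulus_bound:
  fixes q y :: complex
  assumes "norm q < norm y" "norm y < 1" "0 < norm q" "norm q < 1"
  shows "1 / \<bar>1 - norm (q powi m * y)\<bar> \<le> (if m \<ge> 0 then 1 / (1 - norm y) else norm q powi (-m) / (norm y - norm q))"
proof (cases "m \<ge> 0")
  case True
  have "norm q powi m \<le> 1"
    using power_int_decreasing[of 0 m "norm q"] assms True by auto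
  then have "norm (q powi m * y) \<le> norm y"
    by (simp add: norm_mult norm_power_int mult_left_le_one_le)
  then show ?thesis using True assms by (auto intro!: frac_le)
next
  case False
  have "norm q powi (-m) \<le> norm q"
    using power_int_decreasing[of 1 "-m" "norm q"] assms False by auto
  then have "norm y - norm q \<le> norm q powi (-m) * (norm (q powi m * y) - 1)"
    using assms by (simp add: norm_mult norm_power_int power_int_minus field_simps)
  moreover have "norm (q powi m * y) - 1 \<le> \<bar>1 - norm (q powi m * y)\<bar>" by simp
  ultimately have "norm y - norm q \<le> norm q powi (-m) * \<bar>1 - norm (q powi m * y)\<bar>"
    using assms by (smt (verit) mult_left_mono zero_le_power_int)
  moreover have "\<bar>1 - norm (q powi m * y)\<bar> > 0" using annulus_ne_1[of q y m] assms by simp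
  ultimately show ?thesis using False assms by (simp add: field_simps)
qed

text \<open>In the annulus the two signs are \<open>sg n\<close> and \<open>sg m\<close>, as in the
  classical Kronecker series. Reading them off the moduli of \<open>q powi n * x\<close> and
  \<open>q powi m * y\<close> instead makes the term covariant when \<open>x\<close> or
  \<open>y\<close> is multiplied by a power of \<open>q\<close>, so that the same formula holds in
  every annulus.\<close>

definition kron_term :: "complex \<Rightarrow> complex \<Rightarrow> complex \<Rightarrow> int \<times> int \<Rightarrow> complex" where
  "kron_term x y q = (\<lambda>(m, n). (sw (q powi n * x) + sw (q powi m * y)) / 2 * (x powi m * y powi n * q powi (m * n)))"

lemma kron_row:
  assumes x: "norm q < norm x" "norm x < 1" and y: "norm q < norm y" "norm y < 1"
    and q: "0 < norm q" "norm q < 1"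
  shows "((\<lambda>n. kron_term x y q (m, n)) has_sum x powi m / (1 - q powi m * y)) UNIV"
    and "((\<lambda>n. norm (kron_term x y q (m, n))) has_sum norm x powi m * (1 / \<bar>1 - norm (q powi m * y)\<bar>)) UNIV"
proof -
  have nz: "x \<noteq> 0" "y \<noteq> 0" "q \<noteq> 0" using assms by auto
  have e: "kron_term x y q (m, n) = x powi m * ((sg n + sw (q powi m * y)) / 2 * (q powi m * y) powi n)" for n
    using sw_annulus[OF x q(1), of n] by (simp add: kron_term_def power_int_mult_distrib power_int_mult)
  have ne: "norm (q powi m * y) \<noteq> 1" "q powi m * y \<noteq> 0"
    using annulus_ne_1[OF y q(1)] nz by auto
  show "((\<lambda>n. kron_term x y q (m, n)) has_sum x powi m / (1 - q powi m * y)) UNIV"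
    using has_sum_cmult_right[OF geometric_has_sum[OF ne], of "x powi m"] by (simp add: e)
  show "((\<lambda>n. norm (kron_term x y q (m, n))) has_sum norm x powi m * (1 / \<bar>1 - norm (q powi m * y)\<bar>)) UNIV"
    using has_sum_cmult_right[OF geometric_norm_has_sum[OF ne], of "norm x powi m"]
    by (simp only: e norm_mult norm_power_int)
qed

lemma kron_summable_annulus:
  assumes x: "norm q < norm x" "norm x < 1" and y: "norm q < norm y" "norm y < 1"
    and q: "0 < norm q" "norm q < 1"
  shows "kron_term x y q summable_on UNIV"
proof -
  have nz: "x \<noteq> 0" "y \<noteq> 0" "q \<noteq> 0" using assms by auto
  define g where "g = (\<lambda>m. norm x powi m * (1 / \<bar>1 - norm (q powi m * y)\<bar>))"
  have "g summable_on UNIV"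
  proof (rule summable_on_int_halves)
    have bd: "norm (g m) \<le> norm x powi m * (if m \<ge> 0 then 1 / (1 - norm y) else norm q powi (-m) / (norm y - norm q))" for m
    proof -
      have "norm (g m) = norm x powi m * (1 / \<bar>1 - norm (q powi m * y)\<bar>)"
        unfolding g_def real_norm_def by (rule abs_of_nonneg) simp
      then show ?thesis using mult_left_mono[OF annulus_bound[OF y q, of m], of "norm x powi m"] by simp
    qed
    show "(\<lambda>n. g (int n)) summable_on UNIV"
    proof (rule norm_summable_imp_summable_on, rule summable_comparison_test'[where N = 0])
      show "summable (\<lambda>n. norm x ^ n * (1 / (1 - norm y)))"
        by (intro summable_mult2 summable_geometric) (use x in auto)
      show "norm (norm (g (int n))) \<le> norm x ^ n * (1 / (1 - norm y))" for n
        using bd[of "int n"] by simp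
    qed
    \<comment> \<open>For negative \<open>m\<close> the denominator grows like
      \<open>norm q powi m\<close>, which turns \<open>norm x powi m\<close> into a power of
      \<open>norm q / norm x < 1\<close>. Index 0 is left out because it obeys the other
      bound.\<close>
    show "(\<lambda>n. g (- int n)) summable_on UNIV"
    proof (rule norm_summable_imp_summable_on, rule summable_comparison_test'[where N = 1])
      show "summable (\<lambda>n. (norm q / norm x) ^ n * (1 / (norm y - norm q)))"
        by (intro summable_mult2 summable_geometric) (use x q nz in \<open>auto simp: divide_less_eq_1\<close>)
      show "norm (norm (g (- int n))) \<le> (norm q / norm x) ^ n * (1 / (norm y - norm q))" if "n \<ge> 1" for n
        using bd[of "- int n"] that nz by (simp add: power_int_minus power_divide field_simps split: if_splits)
    qed
  qed
  then have "kron_term x y q summable_on (UNIV \<times> UNIV)"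
    by (rule summable_on_prodI[rotated]) (use kron_row(2)[OF assms] in \<open>simp add: g_def\<close>)
  then show ?thesis by simp
qed

lemma kron_sym: "infsum (kron_term x y q) UNIV = infsum (kron_term y x q) UNIV"
  by (rule infsum_reindex_bij_witness[of _ prod.swap prod.swap]) (auto simp: kron_term_def mult_ac add_ac)

text \<open>The coefficients of \<open>Theta x q\<close> times the Kronecker sum as a Laurent series in \<open>x\<close> are
  \<open>(-1)\<^sup>j q\<^bsup>j(j-1)/2\<^esup> d j\<close> with the sums \<open>d\<close> below; since \<open>Theta\<close> vanishes at the powers of \<open>q\<close>,
  \<open>d j = y * d (j - 1)\<close>.\<close>
definition kron_coeff :: "complex \<Rightarrow> complex \<Rightarrow> int \<Rightarrow> complex" where
  "kron_coeff y q j = (\<Sum>\<^sub>\<infinity>i. (-1) powi i * q powi (choose2 (i + 1) - i * j) / (1 - q powi i * y))"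

context
  fixes y q :: complex
  assumes y: "norm q < norm y" "norm y < 1" and q: "0 < norm q" "norm q < 1"
begin

lemma kron_coeff_has_sum:
  "((\<lambda>i. (-1) powi i * q powi (choose2 (i + 1) - i * j) / (1 - q powi i * y)) has_sum kron_coeff y q j) UNIV"
  unfolding kron_coeff_def
proof (rule has_sum_infsum)
  have nz: "q \<noteq> 0" using q by auto
  define C where "C = max (1 / (1 - norm y)) (1 / (norm y - norm q))"
  have bd: "norm (1 / (1 - q powi i * y)) \<le> C" for i
  proof -
    have "norm (1 / (1 - q powi i * y)) \<le> 1 / \<bar>1 - norm (q powi i * y)\<bar>"
      using annulus_ne_1[OF y q(1), of i] norm_triangle_ineq3[of 1 "q powi i * y"]
      by (simp add: norm_divide del: norm_mult) (intro frac_le; simp)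
    also have "\<dots> \<le> C"
    proof (cases "i \<ge> 0")
      case True
      then show ?thesis using annulus_bound[OF y q, of i] by (simp add: C_def)
    next
      case False
      have "norm q powi (-i) \<le> 1"
        using power_int_decreasing[of 0 "-i" "norm q"] q False by auto
      then have "norm q powi (-i) / (norm y - norm q) \<le> 1 / (norm y - norm q)"
        using y by (intro divide_right_mono) auto
      then show ?thesis using annulus_bound[OF y q, of i] False by (simp add: C_def)
    qed
    finally show ?thesis .
  qed
  have "(\<lambda>i. norm (q powi choose2 i * (q powi (1 - j)) powi i) * C) summable_on UNIV"
    using theta_summable[OF q, of "q powi (1 - j)"] nz
    by (intro summable_on_cmult_left) (simp add: summable_on_iff_abs_summable_on_complex)
  then have "(\<lambda>i. norm ((-1) powi i * q powi (choose2 (i + 1) - i * j) / (1 - q powi i * y))) summable_on UNIV"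
  proof (rule Infinite_Sum.abs_summable_on_comparison_test')
    fix i
    have "q powi choose2 i * (q powi (1 - j)) powi i = q powi (choose2 (i + 1) - i * j)"
      using nz by (simp add: choose2_Suc flip: power_int_add power_int_mult) (simp add: algebra_simps)
    then show "norm ((-1) powi i * q powi (choose2 (i + 1) - i * j) / (1 - q powi i * y)) \<le> norm (q powi choose2 i * (q powi (1 - j)) powi i) * C"
      using mult_left_mono[OF bd[of i], of "norm (q powi (choose2 (i + 1) - i * j))"]
      by (simp add: norm_mult norm_divide norm_power_int)
  qed
  then show "(\<lambda>i. (-1) powi i * q powi (choose2 (i + 1) - i * j) / (1 - q powi i * y)) summable_on UNIV"
    by (rule abs_summable_summable)
qed

lemma kron_coeff_rec: "kron_coeff y q j = y * kron_coeff y q (j - 1)"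
proof -
  have nz: "q \<noteq> 0" using q by auto
  have "((\<lambda>i. (-1) powi i * q powi (choose2 (i + 1) - i * j) / (1 - q powi i * y)
        - y * ((-1) powi i * q powi (choose2 (i + 1) - i * (j - 1)) / (1 - q powi i * y)))
       has_sum (kron_coeff y q j - y * kron_coeff y q (j - 1))) UNIV"
    by (intro has_sum_minus has_sum_cmult_right kron_coeff_has_sum)
  \<comment> \<open>The numerators differ by the factor \<open>1 - q powi i * y\<close>, which
    cancels the denominator and leaves the Jacobi series at \<open>q powi (1 - j)\<close>, a zero of
    \<open>Theta\<close>.\<close>
  moreover have "(-1) powi i * q powi (choose2 (i + 1) - i * j) / (1 - q powi i * y)
        - y * ((-1) powi i * q powi (choose2 (i + 1) - i * (j - 1)) / (1 - q powi i * y))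
      = (-1) powi i * q powi choose2 i * (q powi (1 - j)) powi i" for i
  proof -
    define E where "E = (-1) powi i * q powi (choose2 (i + 1) - i * j)"
    define v where "v = q powi i * y"
    have v: "1 - v \<noteq> 0" using annulus_ne_1[OF y q(1), of i] by (auto simp: v_def)
    have "q powi (choose2 (i + 1) - i * (j - 1)) = q powi (choose2 (i + 1) - i * j) * q powi i"
      using nz by (simp flip: power_int_add) (simp add: algebra_simps)
    then have "(-1) powi i * q powi (choose2 (i + 1) - i * j) / (1 - q powi i * y)
        - y * ((-1) powi i * q powi (choose2 (i + 1) - i * (j - 1)) / (1 - q powi i * y)) = E / (1 - v) - E * v / (1 - v)"
      by (simp add: E_def v_def)
    also have "\<dots> = E * (1 - v) / (1 - v)" by (simp add: right_diff_distrib diff_divide_distrib)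
    also have "\<dots> = E" using v by simp
    also have "q powi (choose2 (i + 1) - i * j) = q powi choose2 i * (q powi (1 - j)) powi i"
      using nz by (simp add: choose2_Suc flip: power_int_add power_int_mult) (simp add: algebra_simps)
    then have "E = (-1) powi i * q powi choose2 i * (q powi (1 - j)) powi i" by (simp add: E_def)
    finally show ?thesis .
  qed
  ultimately have "((\<lambda>i. (-1) powi i * q powi choose2 i * (q powi (1 - j)) powi i) has_sum
      (kron_coeff y q j - y * kron_coeff y q (j - 1))) UNIV" by simp
  moreover have "((\<lambda>i. (-1) powi i * q powi choose2 i * (q powi (1 - j)) powi i) has_sum Theta (q powi (1 - j)) q) UNIV"
    by (rule jacobi_triple) (use q nz in auto)
  moreover have "Theta (q powi (1 - j)) q = 0" using Theta_eq_0_iff[OF q] nz by auto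
  ultimately show ?thesis using has_sum_unique by fastforce
qed

lemma kron_coeff_powi: "kron_coeff y q j = y powi j * kron_coeff y q 0"
proof (induction j rule: int_induct[where k = 0])
  case base
  then show ?case by simp
next
  case (step1 i)
  then show ?case using kron_coeff_rec[of "i + 1"] y q by (simp add: power_int_add)
next
  case (step2 i)
  have "y \<noteq> 0" using y q by auto
  then have "kron_coeff y q (i - 1) = kron_coeff y q i / y"
    using kron_coeff_rec[of i] by (simp add: field_simps)
  then show ?case using step2 \<open>y \<noteq> 0\<close> by (simp add: power_int_diff)
qed

lemma Theta_times_kron:
  assumes x: "norm q < norm x" "norm x < 1"
  shows "Theta x q * infsum (kron_term x y q) UNIV = kron_coeff y q 0 * Theta (x * y) q"
proof -
  have nz: "x \<noteq> 0" "y \<noteq> 0" "q \<noteq> 0" using x y q by auto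
  have "(kron_term x y q has_sum infsum (kron_term x y q) UNIV) (UNIV \<times> UNIV)"
    using has_sum_infsum[OF kron_summable_annulus[OF x y q]] by simp
  then have K: "((\<lambda>m. x powi m / (1 - q powi m * y)) has_sum infsum (kron_term x y q) UNIV) UNIV"
    by (rule has_sum_SigmaD) (rule kron_row(1)[OF x y q])
  have "((\<lambda>(k, m). ((-1) powi k * q powi choose2 k * x powi k) * (x powi m / (1 - q powi m * y)))
      has_sum Theta x q * infsum (kron_term x y q) UNIV) (UNIV \<times> UNIV)"
    by (rule has_sum_prod_mult[OF jacobi_triple[OF q nz(1)] K])
  \<comment> \<open>Grouping by the total power \<open>j = k + m\<close> of \<open>x\<close> exposes
    \<open>kron_coeff\<close>; the exponents separate because
    \<open>choose2 k = choose2 (k + m) + choose2 (m + 1) - m * (k + m)\<close>.\<close>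
  also have "?this \<longleftrightarrow> ((\<lambda>(j, i). ((-1) powi j * q powi choose2 j * x powi j) * ((-1) powi i * q powi (choose2 (i + 1) - i * j) / (1 - q powi i * y)))
      has_sum Theta x q * infsum (kron_term x y q) UNIV) (UNIV \<times> UNIV)"
  proof (rule has_sum_reindex_bij_witness[of _ "\<lambda>(j, i). (j - i, i)" "\<lambda>(k, m). (k + m, m)"], goal_cases)
    case (5 a)
    obtain k m where a: "a = (k, m)" by force
    have "q powi choose2 (k + m) * q powi (choose2 (m + 1) - m * (k + m)) = q powi choose2 k"
    proof -
      have "2 * (choose2 (k + m) + (choose2 (m + 1) - m * (k + m))) = 2 * choose2 k"
        using two_choose2[of "k + m"] two_choose2[of "m + 1"] two_choose2[of k] by (simp add: algebra_simps)
      then have "choose2 (k + m) + (choose2 (m + 1) - m * (k + m)) = choose2 k" by (subst (asm) mult_left_cancel) auto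
      then show ?thesis using nz by (metis power_int_add)
    qed
    moreover have "(-1) powi (k + m) * (-1) powi m = ((-1) powi k :: complex)"
      by (simp add: power_int_add)
    ultimately have "((-1) powi (k + m) * (-1) powi m) * (q powi choose2 (k + m) * q powi (choose2 (m + 1) - m * (k + m)))
        = (-1) powi k * q powi choose2 k" by (simp only:)
    then have "((-1) powi (k + m) * q powi choose2 (k + m)) * ((-1) powi m * q powi (choose2 (m + 1) - m * (k + m)))
        = (-1) powi k * q powi choose2 k" by (simp only: mult_ac)
    then show ?case using nz unfolding a
      by (simp add: power_int_add[of x] mult_ac)
  qed auto
  finally have "((\<lambda>(j, i). ((-1) powi j * q powi choose2 j * x powi j) * ((-1) powi i * q powi (choose2 (i + 1) - i * j) / (1 - q powi i * y)))
      has_sum Theta x q * infsum (kron_term x y q) UNIV) (UNIV \<times> UNIV)" .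
  then have "((\<lambda>j. ((-1) powi j * q powi choose2 j * x powi j) * kron_coeff y q j)
      has_sum Theta x q * infsum (kron_term x y q) UNIV) UNIV"
    by (rule has_sum_SigmaD) (simp only: prod.case, intro has_sum_cmult_right kron_coeff_has_sum)
  moreover have "((\<lambda>j. kron_coeff y q 0 * ((-1) powi j * q powi choose2 j * (x * y) powi j))
      has_sum kron_coeff y q 0 * Theta (x * y) q) UNIV"
    by (intro has_sum_cmult_right jacobi_triple) (use q nz in auto)
  moreover have "((-1) powi j * q powi choose2 j * x powi j) * kron_coeff y q j
     = kron_coeff y q 0 * ((-1) powi j * q powi choose2 j * (x * y) powi j)" for j
    by (subst kron_coeff_powi) (simp add: power_int_mult_distrib)
  ultimately show ?thesis using has_sum_unique by fastforce
qed

end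

section \<open>The constant in Kronecker's formula, from the behaviour at 1\<close>

lemma Theta_div_tendsto:
  assumes q: "0 < norm q" "norm q < 1"
  shows "((\<lambda>x. Theta x q / (1 - x)) \<longlongrightarrow> qpoch_inf q q ^ 3) (at 1)"
proof -
  define \<phi> where "\<phi> = (\<lambda>x. qpoch_inf (q * x) q * qpoch_inf (q / x) q * qpoch_inf q q)"
  have "isCont (\<lambda>x. qpoch_inf (q * x) q) 1" "isCont (\<lambda>x. qpoch_inf (q / x) q) 1"
    by (rule isCont_o2[OF _ isCont_qpoch[OF q(2)]]; auto intro!: continuous_intros)+
  then have "isCont \<phi> 1" unfolding \<phi>_def by (auto intro!: continuous_intros)
  then have "(\<phi> \<longlongrightarrow> qpoch_inf q q ^ 3) (at 1)"
    by (auto simp: isCont_def \<phi>_def power3_eq_cube mult_ac)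
  moreover have "\<forall>\<^sub>F x in at 1. \<phi> x = Theta x q / (1 - x)"
    unfolding eventually_at
  proof (intro exI[of _ 1] conjI ballI impI)
    fix x :: complex assume "x \<noteq> 1 \<and> dist x 1 < 1"
    then show "\<phi> x = Theta x q / (1 - x)"
      using qpoch_Suc[OF q(2), of x] by (simp add: \<phi>_def Theta_def)
  qed simp
  ultimately show ?thesis by (rule Lim_transform_eventually)
qed

text \<open>Only the term \<open>i = 0\<close> has a pole at \<open>t = 1\<close>, and the factor
  \<open>1 - t\<close> turns it into the constant 1. All other terms tend to 0 under a bound uniform
  in \<open>t\<close>.\<close>

lemma kron_coeff_tendsto:
  assumes q: "0 < norm q" "norm q < 1"
  shows "((\<lambda>t::real. (1 - of_real t) * kron_coeff (of_real t) q 0) \<longlongrightarrow> 1) (at_left 1)"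
proof -
  define f where "f = (\<lambda>i (t::real). (-1) powi i * q powi choose2 (i + 1) * ((1 - of_real t) / (1 - q powi i * of_real t)))"
  have nz: "q \<noteq> 0" using q by auto
  have qi: "norm (q powi i) \<noteq> 1" if "i \<noteq> 0" for i
    using powi_eq_1[OF q, of i] that by (auto simp: norm_power_int)
  \<comment> \<open>For \<open>t > r\<close> and \<open>i \<le> -1\<close> this choice gives
    \<open>norm q powi i * t \<ge> 1 / r > 1\<close>, which keeps the denominators of negative index
    away from 0.\<close>
  define r where "r = sqrt (norm q)"
  have r: "norm q < r" "r < 1" "r * r = norm q"
    using q by (auto simp: r_def real_less_rsqrt power2_eq_square intro!: real_less_rsqrt)
  have r0: "r > 0" using r(1) q by linarith
  define C where "C = max 1 (max (1 / (1 - norm q)) (1 / (1 / r - 1)))"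
  have bd: "norm ((1 - of_real t) / (1 - q powi i * of_real t)) \<le> C" if t: "r < t" "t < 1" for t i
  proof -
    have t0: "t > 0" using t r q by linarith
    define d where "d = norm (1 - q powi i * of_real t)"
    have n: "norm (q powi i * of_real t) = norm q powi i * t" using t0 by (simp add: norm_mult norm_power_int)
    have tri: "\<bar>1 - norm q powi i * t\<bar> \<le> d"
      using norm_triangle_ineq3[of 1 "q powi i * of_real t"] n by (simp add: d_def)
    have e: "norm ((1 - of_real t) / (1 - q powi i * of_real t)) = (1 - t) / d"
      using t by (simp add: norm_divide d_def flip: of_real_diff) (metis abs_of_pos diff_gt_0_iff_gt norm_of_real of_real_1 of_real_diff)
    consider "i = 0" | "i \<ge> 1" | "i \<le> -1" by linarith
    then show ?thesis
    proof cases
      case 1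
      then have "d \<ge> 1 - t" using tri by simp
      then have "(1 - t) / d \<le> 1" using t by (simp add: divide_le_eq_1)
      then show ?thesis by (simp add: e C_def)
    next
      case 2
      have "norm q powi i \<le> norm q" using power_int_decreasing[of 1 i "norm q"] q 2 by auto
      then have "norm q powi i * t \<le> norm q * 1" using t t0 q by (intro mult_mono) auto
      then have "1 - norm q \<le> d" using tri by linarith
      then have "(1 - t) / d \<le> 1 / (1 - norm q)" using t t0 q by (intro frac_le) auto
      then show ?thesis by (simp add: e C_def)
    next
      case 3
      have "norm q powi (-1) \<le> norm q powi i" using power_int_decreasing[of i "-1" "norm q"] q 3 by auto
      then have "norm q powi (-1) * r \<le> norm q powi i * t" using t t0 q r0 by (intro mult_mono) auto
      moreover have "norm q powi (-1) * r = 1 / r" using r0 by (simp add: power_int_minus field_simps flip: r(3))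
      ultimately have "1 / r - 1 \<le> d" using tri by linarith
      moreover have "1 / r - 1 > 0" using r r0 by simp
      ultimately have "(1 - t) / d \<le> 1 / (1 / r - 1)" using t t0 by (intro frac_le) auto
      then show ?thesis by (simp add: e C_def)
    qed
  qed
  have sm: "(\<lambda>i. norm ((-1) powi i * q powi choose2 (i + 1)) * C) summable_on UNIV"
  proof -
    have "(\<lambda>i. norm (q powi choose2 i * q powi i) * C) summable_on UNIV"
      using theta_summable[OF q nz]
      by (intro summable_on_cmult_left) (simp add: summable_on_iff_abs_summable_on_complex)
    then show ?thesis using nz by (simp add: norm_mult norm_power_int choose2_Suc power_int_add)
  qed
  have "((\<lambda>t. \<Sum>\<^sub>\<infinity>i. f i t) \<longlongrightarrow> (\<Sum>\<^sub>\<infinity>i::int. if i = 0 then 1 else 0)) (at_left 1)"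
  proof (rule tendsto_infsum_dominated[OF _ _ sm])
    have ev: "\<forall>\<^sub>F t in at_left 1. r < t \<and> t < 1"
      using r by (simp add: eventually_at_left_field) (use r in blast)
    then show "\<forall>\<^sub>F t in at_left 1. \<forall>i\<in>UNIV. norm (f i t) \<le> norm ((-1) powi i * q powi choose2 (i + 1)) * C"
    proof eventually_elim
      case (elim t)
      then show ?case unfolding f_def norm_mult[of _ "_ / _"]
        by (intro ballI mult_left_mono bd) auto
    qed
    fix i :: int
    show "((\<lambda>t. f i t) \<longlongrightarrow> (if i = 0 then 1 else 0)) (at_left 1)"
    proof (cases "i = 0")
      case True
      have "\<forall>\<^sub>F t in at_left 1. 1 = f i t"
        using ev by eventually_elim (auto simp: f_def True)
      from Lim_transform_eventually[OF tendsto_const this] show ?thesis using True by simp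
    next
      case False
      have "((\<lambda>t. f i t) \<longlongrightarrow> (-1) powi i * q powi choose2 (i + 1) * ((1 - of_real 1) / (1 - q powi i * of_real 1))) (at_left 1)"
        unfolding f_def by (intro tendsto_intros) (use qi[OF False] in auto)
      then show ?thesis using False by simp
    qed
  qed simp
  moreover have "(\<Sum>\<^sub>\<infinity>i::int. if i = 0 then 1 else 0 :: complex) = 1"
    by (intro infsumI has_sum_finite_neutralI[of "{0}"]) auto
  moreover have "(\<Sum>\<^sub>\<infinity>i. f i t) = (1 - of_real t) * kron_coeff (of_real t) q 0" for t
  proof -
    have "f i t = (1 - of_real t) * ((-1) powi i * q powi (choose2 (i + 1) - i * 0) / (1 - q powi i * of_real t))" for i
      by (simp add: f_def)
    then show ?thesis unfolding kron_coeff_def by (simp only: infsum_cmult_right')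
  qed
  ultimately show ?thesis by simp
qed

lemma Theta_annulus_nonzero:
  assumes z: "norm q < norm z" "norm z < 1" and q: "0 < norm q" "norm q < 1"
  shows "Theta z q \<noteq> 0"
proof
  assume "Theta z q = 0"
  moreover have "z \<noteq> 0" using z q by auto
  ultimately obtain k where "z = q powi k" using Theta_eq_0_iff[OF q] by auto
  then have "q powi (- k) * z = 1" using q by (simp add: power_int_minus)
  then show False using annulus_ne_1[OF z q(1), of "-k"] by simp
qed

text \<open>The Kronecker sum is symmetric, so \<open>Theta_times_kron\<close> read for
  \<open>(x, y)\<close> and for \<open>(y, x)\<close> shows that
  \<open>kron_coeff y q 0 * Theta y q\<close> does not depend on \<open>y\<close>. Its value appears
  as \<open>y\<close> tends to 1, where the simple pole of the first factor meets the simple zero of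
  the second.\<close>

lemma kron_coeff_times_Theta:
  assumes y: "norm q < norm y" "norm y < 1" and q: "0 < norm q" "norm q < 1"
  shows "kron_coeff y q 0 * Theta y q = qpoch_inf q q ^ 3"
proof -
  have y0: "y \<noteq> 0" using y q by auto
  \<comment> \<open>The bound \<open>norm q / norm y < t\<close> keeps \<open>t * y\<close> in the
    annulus, where \<open>Theta (t * y) q\<close> is nonzero and can be cancelled.\<close>
  have ev: "\<forall>\<^sub>F t in at_left 1. norm q / norm y < t \<and> norm q < t \<and> t < 1"
    using eventually_at_left_real[of "max (norm q / norm y) (norm q)" 1] y q y0
    by (auto elim!: eventually_mono simp: divide_less_eq_1)
  then have eq: "\<forall>\<^sub>F t in at_left 1. ((1 - of_real t) * kron_coeff (of_real t) q 0) * (Theta (of_real t) q / (1 - of_real t))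
      = kron_coeff y q 0 * Theta y q"
  proof eventually_elim
    case (elim t)
    define x where "x = complex_of_real t"
    have t0: "t > 0" using elim q by linarith
    have x: "norm q < norm x" "norm x < 1" using elim t0 by (auto simp: x_def)
    have xy: "norm q < norm (x * y)" "norm (x * y) < 1"
      using elim y y0 t0 mult_strict_mono[of t 1 "norm y" 1] by (auto simp: x_def norm_mult field_simps)
    have "Theta (x * y) q \<noteq> 0" by (rule Theta_annulus_nonzero[OF xy q])
    moreover have "kron_coeff y q 0 * Theta y q * Theta (x * y) q = kron_coeff x q 0 * Theta x q * Theta (x * y) q"
    proof -
      have "Theta x q * infsum (kron_term x y q) UNIV = kron_coeff y q 0 * Theta (x * y) q"
        "Theta y q * infsum (kron_term x y q) UNIV = kron_coeff x q 0 * Theta (x * y) q"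
        using Theta_times_kron[OF y q x] Theta_times_kron[OF x q y] kron_sym[of x y q] by (simp_all add: mult.commute)
      then show ?thesis by (metis mult.assoc mult.left_commute)
    qed
    ultimately have "kron_coeff y q 0 * Theta y q = kron_coeff x q 0 * Theta x q" by simp
    moreover have "1 - x \<noteq> 0" using elim by (auto simp: x_def)
    ultimately show ?case by (simp add: x_def)
  qed
  have "filterlim complex_of_real (at 1) (at_left 1)"
    unfolding filterlim_at by (auto intro!: tendsto_eq_intros simp: eventually_at_left_field intro: exI[of _ 0])
  then have "((\<lambda>t::real. ((1 - of_real t) * kron_coeff (of_real t) q 0) * (Theta (of_real t) q / (1 - of_real t))) \<longlongrightarrow> 1 * qpoch_inf q q ^ 3) (at_left 1)"
    by (intro tendsto_mult kron_coeff_tendsto q filterlim_compose[OF Theta_div_tendsto[OF q]])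
  from Lim_transform_eventually[OF this eq]
  have "((\<lambda>t::real. kron_coeff y q 0 * Theta y q) \<longlongrightarrow> qpoch_inf q q ^ 3) (at_left 1)" by simp
  from tendsto_unique[OF _ tendsto_const this] show ?thesis by simp
qed

lemma kron_annulus:
  assumes x: "norm q < norm x" "norm x < 1" and y: "norm q < norm y" "norm y < 1"
    and q: "0 < norm q" "norm q < 1"
  shows "(kron_term x y q has_sum qpoch_inf q q ^ 3 * Theta (x * y) q / (Theta x q * Theta y q)) UNIV"
proof -
  define S where "S = infsum (kron_term x y q) UNIV"
  have "S * (Theta x q * Theta y q) = (Theta x q * S) * Theta y q" by (simp add: mult_ac)
  also have "\<dots> = (kron_coeff y q 0 * Theta y q) * Theta (x * y) q"
    using Theta_times_kron[OF y q x] by (simp add: S_def mult_ac)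
  also have "\<dots> = qpoch_inf q q ^ 3 * Theta (x * y) q"
    by (simp only: kron_coeff_times_Theta[OF y q])
  finally have "S = qpoch_inf q q ^ 3 * Theta (x * y) q / (Theta x q * Theta y q)"
    using Theta_annulus_nonzero[OF x q] Theta_annulus_nonzero[OF y q] by (simp add: eq_divide_eq)
  then show ?thesis using has_sum_infsum[OF kron_summable_annulus[OF assms]] by (simp add: S_def)
qed

lemma annulus_rep:
  fixes q x :: complex
  assumes q: "0 < norm q" "norm q < 1" and x: "x \<noteq> 0" "\<And>k. norm (q powi k * x) \<noteq> 1"
  obtains k x' where "x = q powi k * x'" "norm q < norm x'" "norm x' < 1"
proof -
  \<comment> \<open>Since \<open>ln (norm q) < 0\<close>, the floor leaves
    \<open>ln (norm x')\<close> above \<open>ln (norm q)\<close> and at most 0; the excluded modulus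
    1 removes the endpoint 0.\<close>
  define k where "k = \<lfloor>ln (norm x) / ln (norm q)\<rfloor>"
  define x' where "x' = q powi (- k) * x"
  have q0: "q \<noteq> 0" and lq: "ln (norm q) < 0" using q by auto
  have "ln (norm q powi (- k)) = - k * ln (norm q)"
  proof -
    have "norm q powi (- k) = norm q powr real_of_int (- k)"
      by (rule powr_real_of_int'[symmetric]) (use q in auto)
    then show ?thesis using q by (simp add: ln_powr)
  qed
  then have "ln (norm x') = ln (norm x) - k * ln (norm q)"
    using x(1) q0 by (simp add: x'_def norm_mult norm_power_int ln_mult_pos)
  moreover have "k \<le> ln (norm x) / ln (norm q)" "ln (norm x) / ln (norm q) < k + 1"
    unfolding k_def by linarith+
  ultimately have "ln (norm x') \<le> 0" "ln (norm q) < ln (norm x')"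
    using lq by (auto simp: field_simps)
  moreover have "norm x' > 0" using x(1) q0 by (simp add: x'_def)
  ultimately have "norm x' \<le> 1" "norm q < norm x'" using q by auto
  moreover have "norm x' \<noteq> 1" using x(2)[of "-k"] by (simp add: x'_def)
  moreover have "x = q powi k * x'" using q0 by (simp add: x'_def power_int_minus)
  ultimately show ?thesis using that by force
qed

text \<open>Multiplying \<open>x\<close> by \<open>q powi i\<close> and \<open>y\<close> by
  \<open>q powi j\<close> shifts the summation indices and multiplies the sum by a monomial. By
  quasi-periodicity the theta quotient acquires the same monomial, its signs cancelling, so the
  annulus case is enough.\<close>

lemma kron_has_sum:
  assumes q: "0 < norm q" "norm q < 1" and x: "x \<noteq> 0" "\<And>k. norm (q powi k * x) \<noteq> 1"
    and y: "y \<noteq> 0" "\<And>k. norm (q powi k * y) \<noteq> 1"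
  shows "(kron_term x y q has_sum qpoch_inf q q ^ 3 * Theta (x * y) q / (Theta x q * Theta y q)) UNIV"
proof -
  obtain i x' where i: "x = q powi i * x'" "norm q < norm x'" "norm x' < 1" using annulus_rep[OF q x] .
  obtain j y' where j: "y = q powi j * y'" "norm q < norm y'" "norm y' < 1" using annulus_rep[OF q y] .
  have nz: "q \<noteq> 0" "x' \<noteq> 0" "y' \<noteq> 0" using q i j x y by auto
  define c where "c = x' powi (- j) * y' powi (- i) * q powi (- i * j)"
  define K where "K = qpoch_inf q q ^ 3 * Theta (x' * y') q / (Theta x' q * Theta y' q)"
  have "((\<lambda>p. c * kron_term x' y' q p) has_sum c * K) UNIV"
    unfolding K_def by (intro has_sum_cmult_right kron_annulus i j q)
  also have "?this \<longleftrightarrow> (kron_term x y q has_sum c * K) UNIV"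
  proof (rule has_sum_reindex_bij_witness[of _ "\<lambda>(m, n). (m + j, n + i)" "\<lambda>(m, n). (m - j, n - i)"], goal_cases)
    case (5 p)
    obtain m n where p: "p = (m, n)" by force
    have "q powi (n - i) * x = q powi n * x'" "q powi (m - j) * y = q powi m * y'"
      using nz by (simp_all add: i(1) j(1) power_int_diff)
    moreover have "x powi (m - j) * y powi (n - i) * q powi ((m - j) * (n - i))
       = x' powi (m - j) * y' powi (n - i) * q powi (i * (m - j) + j * (n - i) + (m - j) * (n - i))"
      using nz by (simp add: i(1) j(1) power_int_mult_distrib power_int_add mult_ac flip: power_int_mult)
    moreover have "i * (m - j) + j * (n - i) + (m - j) * (n - i) = m * n - i * j"
      by (simp add: algebra_simps)
    ultimately have "kron_term x y q (m - j, n - i) = (sw (q powi n * x') + sw (q powi m * y')) / 2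
        * (x' powi (m - j) * y' powi (n - i) * q powi (m * n - i * j))"
      by (simp only: kron_term_def prod.case)
    also have "x' powi (m - j) * y' powi (n - i) * q powi (m * n - i * j)
        = c * (x' powi m * y' powi n * q powi (m * n))"
      using nz by (simp add: c_def power_int_diff power_int_minus field_simps)
    finally show ?case unfolding p by (simp add: kron_term_def mult_ac)
  qed auto
  also have "c * K = qpoch_inf q q ^ 3 * Theta (x * y) q / (Theta x q * Theta y q)"
  proof -
    have "x * y = q powi (i + j) * (x' * y')" using nz by (simp add: i(1) j(1) power_int_add)
    then have T: "Theta (x * y) q = (-1) powi (i + j) * q powi (- choose2 (i + j)) * (x' * y') powi (- (i + j)) * Theta (x' * y') q"
      using Theta_shift_powi[OF q, of "x' * y'" "i + j"] nz by simp
    show ?thesis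
      unfolding T unfolding i(1) j(1) K_def c_def
      using nz by (simp add: Theta_shift_powi[OF q] choose2_add power_int_add power_int_diff power_int_minus power_int_mult_distrib)
         (simp add: field_simps)
  qed
  finally show ?thesis .
qed

section \<open>Lattice sums for the Hecke and Appell parts\<close>

lemma inverse_annulus_bound:
  fixes Q A :: complex
  assumes Q: "0 < norm Q" "norm Q < 1" and A: "A \<noteq> 0" "\<And>k. norm (Q powi k * A) \<noteq> 1"
  obtains B where "\<And>k. 1 / \<bar>1 - norm (Q powi k * A)\<bar> \<le> B"
proof -
  obtain j A' where j: "A = Q powi j * A'" "norm Q < norm A'" "norm A' < 1"
    using annulus_rep[OF Q A] .
  define B where "B = max (1 / (1 - norm A')) (1 / (norm A' - norm Q))"
  have "1 / \<bar>1 - norm (Q powi k * A)\<bar> \<le> B" for k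
  proof -
    have e: "Q powi k * A = Q powi (k + j) * A'" using Q by (simp add: j(1) power_int_add)
    have "norm Q powi (-(k + j)) / (norm A' - norm Q) \<le> 1 / (norm A' - norm Q)" if "k + j < 0"
      using power_int_decreasing[of 0 "-(k + j)" "norm Q"] that j Q by (intro divide_right_mono) auto
    then show ?thesis
      unfolding e B_def using annulus_bound[OF j(2,3) Q, of "k + j"] by (cases "k + j \<ge> 0") auto
  qed
  then show ?thesis by (rule that)
qed

text \<open>Absolute convergence holds because the distances of \<open>norm (Q powi k * A)\<close>
  from 1 have a common positive lower bound, which leaves the theta majorant
  \<open>norm (Q powi choose2 k)\<close>.\<close>

lemma lerch_has_sum:
  assumes Q: "0 < norm Q" "norm Q < 1" and A: "A \<noteq> 0" "\<And>k. norm (Q powi k * A) \<noteq> 1"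
  shows "((\<lambda>(k, n). Q powi choose2 k * ((sg n + sw (Q powi k * A)) / 2 * (Q powi k * A) powi n))
          has_sum (\<Sum>\<^sub>\<infinity>k. Q powi choose2 k / (1 - Q powi k * A))) UNIV"
proof -
  define f where "f = (\<lambda>(k, n). Q powi choose2 k * ((sg n + sw (Q powi k * A)) / 2 * (Q powi k * A) powi n))"
  have nz: "Q powi k * A \<noteq> 0" for k using Q A by auto
  have inner: "((\<lambda>n. f (k, n)) has_sum Q powi choose2 k / (1 - Q powi k * A)) UNIV" for k
    using has_sum_cmult_right[OF geometric_has_sum[OF A(2) nz], of "Q powi choose2 k" k] by (simp add: f_def)
  have inner_norm: "((\<lambda>n. norm (f (k, n))) has_sum norm (Q powi choose2 k) * (1 / \<bar>1 - norm (Q powi k * A)\<bar>)) UNIV" for k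
    using has_sum_cmult_right[OF geometric_norm_has_sum[OF A(2) nz], of "norm (Q powi choose2 k)" k]
    by (simp only: f_def prod.case norm_mult)
  obtain B where B: "\<And>k. 1 / \<bar>1 - norm (Q powi k * A)\<bar> \<le> B" using inverse_annulus_bound[OF assms] by blast
  have "(\<lambda>k. norm (Q powi choose2 k) * (1 / \<bar>1 - norm (Q powi k * A)\<bar>)) summable_on UNIV"
  proof (rule summable_on_comparison_test)
    show "(\<lambda>k. norm (Q powi choose2 k) * B) summable_on UNIV"
      using theta_summable[OF Q, of 1]
      by (intro summable_on_cmult_left) (simp add: summable_on_iff_abs_summable_on_complex)
    show "norm (Q powi choose2 k) * (1 / \<bar>1 - norm (Q powi k * A)\<bar>) \<le> norm (Q powi choose2 k) * B" for k
      by (rule mult_left_mono[OF B]) simp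
  qed simp
  then have "f summable_on UNIV \<times> UNIV"
    by (rule summable_on_prodI[rotated]) (rule inner_norm)
  then have f: "(f has_sum infsum f (UNIV \<times> UNIV)) (UNIV \<times> UNIV)" by (rule has_sum_infsum)
  from has_sum_SigmaD[OF this inner] have "infsum f (UNIV \<times> UNIV) = (\<Sum>\<^sub>\<infinity>k. Q powi choose2 k / (1 - Q powi k * A))"
    by (rule infsumI[symmetric])
  with f show ?thesis by (simp add: f_def)
qed

text \<open>At \<open>z = -1\<close> the alternating sign and \<open>z powi r\<close> cancel, so the
  coefficients are exactly those of the series for \<open>Theta (-1) Q\<close>. This is what lets
  the Appell parts share one lattice term with \<open>f\<close> times the two theta values.\<close>

lemma appell_m_minus_1:
  "appell_m A (-1) Q = 1 / Theta (-1) Q * (\<Sum>\<^sub>\<infinity>k. Q powi choose2 k / (1 - Q powi (k - 1) * (- A)))"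
proof -
  have eq: "(-1) powi r * Q powi choose2 r * (-1) powi r / (1 - Q powi (r - 1) * A * (-1))
      = Q powi choose2 r / (1 - Q powi (r - 1) * (- A))" for r
  proof -
    have "(-1) powi r * (-1 :: complex) powi r = 1" by (simp flip: power_int_mult_distrib)
    then have "(-1) powi r * Q powi choose2 r * (-1) powi r = Q powi choose2 r"
      by (metis mult.assoc mult.commute mult_1)
    then show ?thesis by simp
  qed
  show ?thesis unfolding appell_m_def by (simp only: eq)
qed

lemma has_sum_finite_Times:
  fixes f :: "'a \<times> 'b \<Rightarrow> complex"
  assumes "finite T" "\<And>t. t \<in> T \<Longrightarrow> ((\<lambda>y. f (t, y)) has_sum S t) B"
  shows "(f has_sum (\<Sum>t\<in>T. S t)) (T \<times> B)"
proof (rule has_sum_SigmaI)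
  show "(S has_sum sum S T) T" using assms(1) by simp
  have "(\<lambda>y. norm (f (t, y))) summable_on B" if "t \<in> T" for t
    using assms(2)[OF that] by (auto simp: summable_on_iff_abs_summable_on_complex dest!: has_sum_imp_summable)
  then show "f summable_on T \<times> B"
    by (intro summable_on_prodI[where g = "\<lambda>t. \<Sum>\<^sub>\<infinity>y\<in>B. norm (f (t, y))"]) (use assms(1) in auto)
qed (use assms in auto)

text \<open>Monomials in \<open>q\<close>, \<open>-x\<close>, \<open>-y\<close> with real exponents,
  over fixed logarithms. No branch has to be chosen again: products and integer powers act linearly
  on the exponents, and an equality of monomials follows from three equalities of real
  numbers.\<close>

definition E3 :: "complex \<Rightarrow> complex \<Rightarrow> complex \<Rightarrow> real \<Rightarrow> real \<Rightarrow> real \<Rightarrow> complex" where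
  "E3 Lq Lx Ly \<alpha> \<beta> \<gamma> = exp (of_real \<alpha> * Lq + of_real \<beta> * Lx + of_real \<gamma> * Ly)"

lemma E3_mult: "E3 Lq Lx Ly \<alpha> \<beta> \<gamma> * E3 Lq Lx Ly \<alpha>' \<beta>' \<gamma>' = E3 Lq Lx Ly (\<alpha> + \<alpha>') (\<beta> + \<beta>') (\<gamma> + \<gamma>')"
  by (simp add: E3_def algebra_simps flip: exp_add)

lemma E3_powi: "E3 Lq Lx Ly \<alpha> \<beta> \<gamma> powi n = E3 Lq Lx Ly (of_int n * \<alpha>) (of_int n * \<beta>) (of_int n * \<gamma>)"
  by (simp add: E3_def exp_power_int algebra_simps)

lemma E3_nonzero [simp]: "E3 Lq Lx Ly \<alpha> \<beta> \<gamma> \<noteq> 0"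
  by (simp add: E3_def)

lemma E3_swap: "E3 Lq Lx Ly \<alpha> \<beta> \<gamma> = E3 Lq Ly Lx \<alpha> \<gamma> \<beta>"
  by (simp add: E3_def algebra_simps)

lemma norm_E3: "norm (E3 Lq Lx Ly \<alpha> \<beta> \<gamma>) = exp (\<alpha> * Re Lq + \<beta> * Re Lx + \<gamma> * Re Ly)"
  by (simp add: E3_def)

lemma E3_q: "exp Lq powi n = E3 Lq Lx Ly (of_int n) 0 0"
  and E3_x: "exp Lx powi n = E3 Lq Lx Ly 0 (of_int n) 0"
  and E3_y: "exp Ly powi n = E3 Lq Lx Ly 0 0 (of_int n)"
  by (simp_all add: E3_def flip: exp_power_int)

lemma cpow_E3: "cpow Lq s = E3 Lq Lx Ly s 0 0" "cpow Lx s = E3 Lq Lx Ly 0 s 0" "cpow Ly s = E3 Lq Lx Ly 0 0 s"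
  by (simp_all add: E3_def cpow_def)

lemma of_int_choose2: "real_of_int (choose2 n) = of_int n * (of_int n - 1) / 2"
proof -
  have "2 * real_of_int (choose2 n) = real_of_int (n * (n - 1))"
    by (simp flip: two_choose2)
  then show ?thesis by simp
qed

definition hecke_term :: "int \<Rightarrow> int \<Rightarrow> int \<Rightarrow> complex \<Rightarrow> complex \<Rightarrow> complex \<Rightarrow> int \<Rightarrow> int \<Rightarrow> complex" where
  "hecke_term a b c Lq Lx Ly r s =
     E3 Lq Lx Ly (of_int (a * choose2 r + b * r * s + c * choose2 s)) (of_int r) (of_int s)"

text \<open>The ratio of the geometric series in the Appell functions of the first sum of \<open>g\<close>, and the inverse
  of the argument of the Kronecker sum, in terms of \<open>u = s - a * k\<close>.\<close>
definition ratio :: "int \<Rightarrow> int \<Rightarrow> int \<Rightarrow> complex \<Rightarrow> complex \<Rightarrow> complex \<Rightarrow> int \<Rightarrow> complex" where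
  "ratio a b c Lq Lx Ly u = (let a' = of_int a; b' = of_int b; c' = of_int c; D = b'\<^sup>2 - a' * c' in
     E3 Lq Lx Ly (- (D * of_int u) - a' * D / 2 + a' * (b' - c') / 2) (- b') a')"

text \<open>Replacing \<open>(r, s, k)\<close> by \<open>(r - b, s + a, k + 1)\<close> leaves
  \<open>u = s - a * k\<close> unchanged and multiplies the term by the ratio at \<open>u\<close>.
  Each orbit is therefore a geometric series. Representatives with \<open>0 \<le> s < a\<close> give
  the index \<open>t\<close>; the sum over \<open>r\<close> is then
  \<open>Theta (q powi (b * t) * x) (q powi a)\<close>, and the geometric series summed over
  \<open>k\<close> give \<open>Theta (-1) Q\<close> times the Appell function.\<close>

lemma appell_part:
  assumes pos: "a > 0" "b > 0" "c > 0" "b\<^sup>2 - a * c > 0" and q: "0 < norm q" "norm q < 1"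
    and L: "exp Lq = q" "exp Lx = - x" "exp Ly = - y"
    and gen: "\<And>u. norm (ratio a b c Lq Lx Ly u) \<noteq> 1"
  defines "Q \<equiv> q powi (a * (b\<^sup>2 - a * c))"
  shows "((\<lambda>((r, s), k). (sg s + sw (ratio a b c Lq Lx Ly (s - a * k))) / 2 *
             (hecke_term a b c Lq Lx Ly r s * Q powi choose2 k))
          has_sum Theta (-1) Q * (\<Sum>t=0..a - 1. (- y) powi t * q powi (c * choose2 t) *
            Theta (q powi (b * t) * x) (q powi a) * appell_m (appell_arg a b c x y q t) (-1) Q)) UNIV"
proof -
  define D where "D = b\<^sup>2 - a * c"
  have nz: "q \<noteq> 0" "x \<noteq> 0" "y \<noteq> 0"
    using L exp_not_eq_zero by (metis neg_equal_0_iff_equal)+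
  have small: "0 < norm (q powi n)" "norm (q powi n) < 1" if "n > 0" for n
    using powi_less_1[OF q, of n] q that by (auto simp: norm_power_int)
  have aD: "a * D > 0" using pos by (simp add: D_def)
  note Qs = small[OF aD, unfolded D_def, folded Q_def]
  have QE: "Q = E3 Lq Lx Ly (of_int (a * D)) 0 0"
    unfolding Q_def D_def[symmetric] L(1)[symmetric] by (rule E3_q)
  have Q0: "Q \<noteq> 0" unfolding QE by simp
  \<comment> \<open>The division by \<open>Q\<close> absorbs the shift \<open>r - 1\<close> in the
    denominators of \<open>appell_m\<close>; the minus sign is the argument
    \<open>z = -1\<close>.\<close>
  define A where "A = (\<lambda>t. - appell_arg a b c x y q t / Q)"
  have AE: "Q powi k * A t = ratio a b c Lq Lx Ly (t - a * k)" for k t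
  proof -
    have "Q powi k * A t = Q powi (k - 1) * (- appell_arg a b c x y q t)"
      using Q0 by (simp add: A_def power_int_diff)
    also have "- appell_arg a b c x y q t = q powi (a * choose2 (b + 1) - c * choose2 (a + 1) - t * D)
        * (exp Ly powi a * exp Lx powi (- b))"
      by (simp add: appell_arg_def D_def L power_int_minus divide_inverse)
    also have "\<dots> = E3 Lq Lx Ly (of_int (a * choose2 (b + 1) - c * choose2 (a + 1) - t * D)) (- of_int b) (of_int a)"
      unfolding L(1)[symmetric] by (simp add: E3_q[of Lq _ Lx Ly] E3_x[of Lx _ Lq Ly] E3_y[of Ly _ Lq Lx] E3_mult)
    also have "Q powi (k - 1) * \<dots> = ratio a b c Lq Lx Ly (t - a * k)"
      unfolding QE E3_powi E3_mult ratio_def Let_def D_def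
      by (rule arg_cong3[where f = "E3 Lq Lx Ly"])
         (simp_all add: of_int_choose2 field_simps power2_eq_square)
    finally show ?thesis .
  qed
  have A0: "A t \<noteq> 0" for t
  proof
    assume "A t = 0"
    then have "ratio a b c Lq Lx Ly t = 0" using AE[of 0 t] by simp
    then show False by (simp add: ratio_def Let_def)
  qed
  define M where "M = (\<lambda>t. appell_m (appell_arg a b c x y q t) (-1) Q)"
  define f where "f = (\<lambda>(t, r, k, n). hecke_term a b c Lq Lx Ly r t * (Q powi choose2 k *
      ((sg n + sw (Q powi k * A t)) / 2 * (Q powi k * A t) powi n)))"
  have summand: "((\<lambda>p. f (t, p)) has_sum Theta (-1) Q * ((- y) powi t * q powi (c * choose2 t) *
            Theta (q powi (b * t) * x) (q powi a) * M t)) UNIV" for t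
  proof -
    have "Theta (-1) Q * M t = (\<Sum>\<^sub>\<infinity>k. Q powi choose2 k / (1 - Q powi k * A t))"
      using Theta_minus_1_nonzero[OF Qs] Q0
      by (simp add: M_def appell_m_minus_1 A_def power_int_diff)
    then have 1: "((\<lambda>(k, n). Q powi choose2 k * ((sg n + sw (Q powi k * A t)) / 2 * (Q powi k * A t) powi n))
          has_sum Theta (-1) Q * M t) UNIV"
      using lerch_has_sum[OF Qs A0[of t]] gen by (simp add: AE)
    have "((\<lambda>r. (q powi a) powi choose2 r * (q powi (b * t) * exp Lx) powi r) has_sum
        Theta (- (q powi (b * t) * exp Lx)) (q powi a)) UNIV"
      by (rule theta_series) (use small[OF pos(1)] nz in auto)
    note T = has_sum_cmult_right[OF this, of "(- y) powi t * q powi (c * choose2 t)"]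
    have eq: "(- y) powi t * q powi (c * choose2 t) * ((q powi a) powi choose2 r * (q powi (b * t) * exp Lx) powi r)
        = hecke_term a b c Lq Lx Ly r t" for r
    proof -
      have "(- y) powi t * q powi (c * choose2 t) * ((q powi a) powi choose2 r * (q powi (b * t) * exp Lx) powi r)
          = exp Lq powi (c * choose2 t) * exp Lq powi (a * choose2 r) * exp Lq powi (b * t * r) * exp Lx powi r * exp Ly powi t"
        by (simp add: power_int_mult_distrib mult_ac flip: L(1,3) power_int_mult)
      also have "\<dots> = hecke_term a b c Lq Lx Ly r t"
        unfolding E3_q[of Lq _ Lx Ly] E3_x[of Lx _ Lq Ly] E3_y[of Ly _ Lq Lx] E3_mult hecke_term_def
        by (rule arg_cong3[where f = "E3 Lq Lx Ly"]) (simp_all add: algebra_simps)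
      finally show ?thesis .
    qed
    have "- (q powi (b * t) * exp Lx) = q powi (b * t) * x" by (simp add: L)
    then have 2: "((\<lambda>r. hecke_term a b c Lq Lx Ly r t) has_sum (- y) powi t * q powi (c * choose2 t) *
            Theta (q powi (b * t) * x) (q powi a)) UNIV"
      using T by (simp only: eq)
    from has_sum_prod_mult[OF 2 1] show ?thesis
      by (simp add: f_def case_prod_unfold mult_ac)
  qed
  have "(f has_sum (\<Sum>t=0..a - 1. Theta (-1) Q * ((- y) powi t * q powi (c * choose2 t) *
            Theta (q powi (b * t) * x) (q powi a) * M t))) ({0..a - 1} \<times> UNIV)"
    by (rule has_sum_finite_Times) (use summand in auto)
  also have "?this \<longleftrightarrow> ?thesis"
  proof (rule has_sum_reindex_bij_witness[of _ "\<lambda>((r, s), k). (s mod a, r + b * (s div a), k - s div a, s div a)"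
        "\<lambda>(t, r, k, n). ((r - b * n, t + a * n), k + n)"], goal_cases)
    case (5 p)
    obtain t r k n where p: "p = (t, r, k, n)" by (cases p) auto
    then have t: "0 \<le> t" "t < a" using 5 by auto
    \<comment> \<open>Since \<open>0 \<le> t < a\<close>, dividing \<open>s = t + a * n\<close> by
      \<open>a\<close> gives \<open>n\<close>, so the sign from the geometric series is the sign of
      \<open>s\<close>.\<close>
    have sgn: "sg (t + a * n) = sg n"
    proof -
      have "(t + a * n) div a = n" using t pos by simp
      then show ?thesis using pos(1) pos_imp_zdiv_nonneg_iff[of a "t + a * n"] by (simp add: sg_def)
    qed
    have r: "t + a * n - a * (k + n) = t - a * k" by (simp add: algebra_simps)
    have "hecke_term a b c Lq Lx Ly (r - b * n) (t + a * n) * Q powi choose2 (k + n) =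
        hecke_term a b c Lq Lx Ly r t * (Q powi choose2 k * (Q powi k * A t) powi n)"
      unfolding AE unfolding QE E3_powi E3_mult ratio_def Let_def D_def hecke_term_def
      by (rule arg_cong3[where f = "E3 Lq Lx Ly"])
         (simp_all add: of_int_choose2 field_simps power2_eq_square)
    then show ?case unfolding p f_def prod.case sgn r AE by (simp add: mult_ac)
  qed (use pos in \<open>auto simp: M_def sum_distrib_left\<close>)
  finally show ?thesis .
qed

text \<open>The weight vanishes unless \<open>r\<close> and \<open>s\<close> have the same sign.
  Then \<open>r * s \<ge> 0\<close>, so the mixed factor has norm at most 1 and the indefinite term
  is dominated by its two diagonal theta terms.\<close>

lemma hecke_f_summable_bound:
  assumes pos: "a > 0" "b > 0" "c > 0" and q: "Re Lq < 0"
  shows "norm (sg2 r s * hecke_term a b c Lq Lx Ly r s) \<le>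
     norm (E3 Lq Lx Ly (of_int (a * choose2 r)) (of_int r) 0) * norm (E3 Lq Lx Ly (of_int (c * choose2 s)) 0 (of_int s))"
proof (cases "sg2 r s = 0")
  case False
  then have "r * s \<ge> 0" and n: "norm (sg2 r s) = 1"
    by (auto simp: sg2_def sg_def mult_nonneg_nonneg mult_nonpos_nonpos split: if_splits)
  then have "real_of_int (b * (r * s)) \<ge> 0" using pos by (simp only: of_int_0_le_iff) simp
  then have "real_of_int (b * (r * s)) * Re Lq \<le> 0" by (rule mult_nonneg_nonpos) (use q in simp)
  then show ?thesis
    unfolding norm_mult n hecke_term_def norm_E3 by (simp add: algebra_simps flip: exp_add)
qed simp

lemma E3_theta_summable:
  assumes "a > 0" "Re Lq < 0"
  shows "(\<lambda>r. E3 Lq Lx Ly (of_int (a * choose2 r)) (of_int r) 0) summable_on UNIV"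
proof -
  have "(\<lambda>r. (exp Lq powi a) powi choose2 r * exp Lx powi r) summable_on UNIV"
    by (rule theta_summable) (use assms powi_less_1[of "exp (Re Lq)" a] in \<open>auto simp: norm_power_int\<close>)
  moreover have "(exp Lq powi a) powi choose2 r * exp Lx powi r = E3 Lq Lx Ly (of_int (a * choose2 r)) (of_int r) 0" for r
    by (simp add: E3_q[of Lq _ Lx Ly] E3_x[of Lx _ Lq Ly] E3_mult E3_powi mult_ac)
  ultimately show ?thesis by simp
qed

lemma hecke_bound_summable:
  assumes pos: "a > 0" "c > 0" and q: "Re Lq < 0"
  shows "(\<lambda>(r, s). norm (E3 Lq Lx Ly (of_int (a * choose2 r)) (of_int r) 0) *
       norm (E3 Lq Lx Ly (of_int (c * choose2 s)) 0 (of_int s))) summable_on UNIV"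
proof -
  have 1: "(\<lambda>r. E3 Lq Lx Ly (of_int (a * choose2 r)) (of_int r) 0) summable_on UNIV"
    by (rule E3_theta_summable) (use assms in auto)
  have 2: "(\<lambda>s. E3 Lq Lx Ly (of_int (c * choose2 s)) 0 (of_int s)) summable_on UNIV"
    unfolding E3_swap[of Lq Lx Ly] by (rule E3_theta_summable) (use assms in auto)
  from has_sum_prod_mult[OF has_sum_infsum[OF 1] has_sum_infsum[OF 2]]
  have "(\<lambda>(r, s). E3 Lq Lx Ly (of_int (a * choose2 r)) (of_int r) 0 *
       E3 Lq Lx Ly (of_int (c * choose2 s)) 0 (of_int s)) summable_on UNIV"
    by (simp add: has_sum_imp_summable)
  then show ?thesis
    by (simp add: summable_on_iff_abs_summable_on_complex norm_mult case_prod_unfold)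
qed

lemma hecke_f_eq:
  assumes L: "exp Lq = q" "exp Lx = - x" "exp Ly = - y"
  shows "hecke_f a b c x y q = (\<Sum>\<^sub>\<infinity>(r, s). sg2 r s * hecke_term a b c Lq Lx Ly r s)"
  unfolding hecke_f_def
proof (rule infsum_cong, clarify)
  fix r s
  have "(-1) powi (r + s) * x powi r * y powi s = exp Lx powi r * exp Ly powi s"
    unfolding L using power_int_mult_distrib[of "-1" x r] power_int_mult_distrib[of "-1" y s]
    by (simp add: power_int_add)
  then have "sg2 r s * (-1) powi (r + s) * x powi r * y powi s * q powi (a * choose2 r + b * r * s + c * choose2 s)
      = sg2 r s * (exp Lq powi (a * choose2 r + b * r * s + c * choose2 s) * exp Lx powi r * exp Ly powi s)"
    by (simp add: L(1) mult_ac)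
  also have "\<dots> = sg2 r s * hecke_term a b c Lq Lx Ly r s"
    unfolding E3_q[of Lq _ Lx Ly] E3_x[of Lx _ Lq Ly] E3_y[of Ly _ Lq Lx] E3_mult hecke_term_def by simp
  finally show "sg2 r s * (-1) powi (r + s) * x powi r * y powi s * q powi (a * choose2 r + b * r * s + c * choose2 s)
      = sg2 r s * hecke_term a b c Lq Lx Ly r s" .
qed

lemma hecke_f_has_sum:
  assumes pos: "a > 0" "b > 0" "c > 0" and q: "norm q < 1"
    and L: "exp Lq = q" "exp Lx = - x" "exp Ly = - y"
  shows "((\<lambda>(r, s). sg2 r s * hecke_term a b c Lq Lx Ly r s) has_sum hecke_f a b c x y q) UNIV"
proof -
  have q': "Re Lq < 0" using q by (simp flip: L(1))
  have "(\<lambda>p. norm (case p of (r, s) \<Rightarrow> sg2 r s * hecke_term a b c Lq Lx Ly r s)) summable_on UNIV"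
    by (rule Infinite_Sum.abs_summable_on_comparison_test'[OF hecke_bound_summable[OF pos(1,3) q', of Lx Ly]])
       (use hecke_f_summable_bound[OF pos q'] in auto)
  then have "(\<lambda>(r, s). sg2 r s * hecke_term a b c Lq Lx Ly r s) summable_on UNIV"
    by (rule abs_summable_summable)
  then show ?thesis unfolding hecke_f_eq[OF L] by (rule has_sum_infsum)
qed

section \<open>Lattice sum for the theta part\<close>

lemma gchoose_2: "(x :: real) gchoose 2 = x * (x - 1) / 2"
  by (simp add: gbinomial_prod_rev numeral_2_eq_2)

text \<open>This makes \<open>d - c / 2\<close> and \<open>e + a / 2\<close> the integers
  \<open>d' - c div 2\<close> and \<open>e' - a div 2 + a\<close>, so the prefactor in the theta
  part is a genuine term of the Hecke sum.\<close>

lemma frac_half: "frac (of_int a / 2 :: real) = of_int a / 2 - of_int (a div 2)"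
  using floor_divide_of_int_eq[where 'a = real, of a 2] by (simp add: frac_def)

lemma sw_inverse: "norm w \<noteq> 1 \<Longrightarrow> w \<noteq> 0 \<Longrightarrow> sw (inverse w) = - sw w"
  using one_less_inverse_iff[of "norm w"] inverse_less_1_iff[of "norm w"] by (auto simp: sw_def norm_inverse)

lemma E3_inverse: "inverse (E3 Lq Lx Ly \<alpha> \<beta> \<gamma>) = E3 Lq Lx Ly (- \<alpha>) (- \<beta>) (- \<gamma>)"
  by (simp add: E3_def algebra_simps flip: exp_minus)

lemma theta_series_E3:
  assumes "Re Lq < 0" "N > 0"
  shows "((\<lambda>l::int. E3 Lq Lx Ly (N * (of_int l * (of_int l - 1) / 2) + of_int l * \<alpha>) (of_int l * \<beta>) (of_int l * \<gamma>))
     has_sum Theta (- E3 Lq Lx Ly \<alpha> \<beta> \<gamma>) (E3 Lq Lx Ly N 0 0)) UNIV"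
proof -
  have "norm (E3 Lq Lx Ly N 0 0) < 1" using assms by (simp add: norm_E3 mult_pos_neg)
  then have "((\<lambda>l. E3 Lq Lx Ly N 0 0 powi choose2 l * E3 Lq Lx Ly \<alpha> \<beta> \<gamma> powi l)
     has_sum Theta (- E3 Lq Lx Ly \<alpha> \<beta> \<gamma>) (E3 Lq Lx Ly N 0 0)) UNIV"
    by (intro theta_series) auto
  then show ?thesis by (simp add: E3_powi E3_mult of_int_choose2 mult_ac add_ac)
qed

definition theta_lattice_term ::
  "int \<Rightarrow> int \<Rightarrow> int \<Rightarrow> complex \<Rightarrow> complex \<Rightarrow> complex \<Rightarrow> (int \<times> int) \<times> (int \<times> int) \<Rightarrow> complex" where
  "theta_lattice_term a b c Lq Lx Ly = (\<lambda>((r, s), (k, l)).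
     hecke_term a b c Lq Lx Ly r s * E3 Lq Lx Ly (of_int ((b\<^sup>2 - a * c) * (a * choose2 k + c * choose2 l))) 0 0)"

text \<open>For fixed residues the sum factors along orthogonal directions. \<open>l\<^sub>0\<close>
  and \<open>j\<close> run through the two theta series, while \<open>m\<close> moves the point
  \<open>(r, s, k, l)\<close> by \<open>(b, -a, -1, 0)\<close> and \<open>n\<close> moves it by
  \<open>(-c, b, 0, -1)\<close>. These vectors are isotropic and orthogonal to the other two
  directions, so \<open>m\<close> and \<open>n\<close> enter the quadratic part of the exponent only
  through \<open>b D m n\<close>, as in a Kronecker sum.

  The 1 in \<open>k\<close> comes from the prefactor: where the four indices vanish, the second
  coordinate is \<open>e - a/2 + a * k\<close>, and it has to be
  \<open>e + a/2 + a * f\<close>.\<close>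

lemma theta_summand:
  fixes a b c d' e' f' :: int
  assumes pos: "a > 0" "b > 0" "c > 0" "b\<^sup>2 - a * c > 0" and q: "Re Lq < 0"
    and gen: "\<And>u. norm (ratio a b c Lq Lx Ly u) \<noteq> 1" "\<And>v. norm (ratio c b a Lq Ly Lx v) \<noteq> 1"
  defines "A \<equiv> real_of_int a" and "B \<equiv> real_of_int b" and "C \<equiv> real_of_int c"
  defines "D \<equiv> B\<^sup>2 - A * C"
  defines "d \<equiv> real_of_int d' + frac (C / 2)" and "e \<equiv> real_of_int e' + frac (A / 2)" and "f \<equiv> real_of_int f'"
  defines "u \<equiv> \<lambda>n. e' + b * n - a div 2" and "v \<equiv> \<lambda>m. d' + b * m - c div 2"
  shows "((\<lambda>(l\<^sub>0, j, m, n). let k = f' + b * j + 1 - m; l = l\<^sub>0 - a * j - n in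
            - (sw (ratio a b c Lq Lx Ly (u n)) + sw (ratio c b a Lq Ly Lx (v m))) / 2 *
              theta_lattice_term a b c Lq Lx Ly ((v m + c * l, u n + a * k), (k, l)))
      has_sum
        (cpow Lq (A * ((d - C / 2) gchoose 2) + B * (d - C / 2) * (e + A / 2) + C * ((e + A / 2) gchoose 2))
          * cpow Lx (d - C / 2) * cpow Ly (e + A / 2))
        * (cpow Lq (A * B\<^sup>2 * (f gchoose 2) + (A * (B * d + B\<^sup>2 + C * e) - A * C * (B + 1) / 2) * f)
            * cpow Ly (A * f)
            * Theta (- cpow Lq (C * (A * d + B * e + A * (B - 1) / 2 + A * B * f)) * cpow Lx C)
                    (cpow Lq (C * B\<^sup>2))
            * Theta (- cpow Lq (A * ((d + B * (B + 1) / 2 + B * f) * (B\<^sup>2 - A * C) + C * (A - B) / 2))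
                       * cpow Lx (- A * C) * cpow Ly (A * B))
                    (cpow Lq (A * B\<^sup>2 * D))
            * ((qpoch_inf (cpow Lq (B * D)) (cpow Lq (B * D))) ^ 3
               * Theta (cpow Lq (D * (d + e) + A * C - B * (A + C) / 2) * cpow Lx (B - C) * cpow Ly (B - A))
                       (cpow Lq (B * D))
               / (Theta (theta_den_arg A B C Lq Lx Ly e) (cpow Lq (B * D))
                  * Theta (theta_den_arg C B A Lq Ly Lx d) (cpow Lq (B * D)))))) UNIV" (is "(?g has_sum ?R) UNIV")
proof -
  note cE = cpow_E3(1)[of Lq _ Lx Ly] cpow_E3(2)[of Lx _ Lq Ly] cpow_E3(3)[of Ly _ Lq Lx]
  have ABC: "A > 0" "B > 0" "C > 0" using pos by (auto simp: A_def B_def C_def)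
  have "D = of_int (b\<^sup>2 - a * c)" by (simp add: D_def A_def B_def C_def)
  then have D: "D > 0" using pos(4) by (simp only: of_int_0_less_iff)
  have d: "d = of_int d' - of_int (c div 2) + C / 2" and e: "e = of_int e' - of_int (a div 2) + A / 2"
    by (simp_all add: d_def e_def A_def C_def frac_half)
  define Q where "Q = E3 Lq Lx Ly (B * D) 0 0"
  define X\<^sub>1 where "X\<^sub>1 = E3 Lq Lx Ly (D * e + A * (C - B) / 2) B (- A)"
  define X\<^sub>2 where "X\<^sub>2 = E3 Lq Lx Ly (D * d + C * (A - B) / 2) (- C) B"
  have Q: "0 < norm Q" "norm Q < 1"
    using q ABC D by (auto simp: Q_def norm_E3 mult_pos_neg)
  have tda: "theta_den_arg A B C Lq Lx Ly e = X\<^sub>1" "theta_den_arg C B A Lq Ly Lx d = X\<^sub>2"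
    by (simp_all add: theta_den_arg_def cE E3_mult X\<^sub>1_def X\<^sub>2_def D_def mult.commute)
  have X12: "X\<^sub>1 * X\<^sub>2 = E3 Lq Lx Ly (D * (d + e) + A * C - B * (A + C) / 2) (B - C) (B - A)"
    unfolding X\<^sub>1_def X\<^sub>2_def E3_mult by (rule arg_cong3[where f = "E3 Lq Lx Ly"]) (simp_all add: field_simps)
  \<comment> \<open>The Kronecker arguments are the inverses of the Appell ratios. Inversion flips
    \<open>sw\<close>, which is the origin of the minus sign in the weight.\<close>
  have r1: "Q powi n * X\<^sub>1 = inverse (ratio a b c Lq Lx Ly (u n))" for n
    unfolding Q_def X\<^sub>1_def E3_powi E3_mult ratio_def Let_def E3_inverse
    by (rule arg_cong3[where f = "E3 Lq Lx Ly"]) (simp_all add: A_def B_def C_def D_def e u_def field_simps power2_eq_square)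
  have r2: "Q powi m * X\<^sub>2 = inverse (ratio c b a Lq Ly Lx (v m))" for m
    unfolding Q_def X\<^sub>2_def E3_powi E3_mult ratio_def Let_def E3_inverse E3_swap[of Lq Ly Lx]
    by (rule arg_cong3[where f = "E3 Lq Lx Ly"]) (simp_all add: A_def B_def C_def D_def d v_def field_simps power2_eq_square)
  have nz: "ratio a b c Lq Lx Ly x \<noteq> 0" "ratio c b a Lq Ly Lx x \<noteq> 0" for x
    by (simp_all add: ratio_def Let_def)
  have n1: "norm (Q powi n * X\<^sub>1) \<noteq> 1" "norm (Q powi n * X\<^sub>2) \<noteq> 1" for n
    unfolding r1 r2 norm_inverse using gen by (auto simp: inverse_eq_1_iff)
  have K: "(kron_term X\<^sub>1 X\<^sub>2 Q has_sum qpoch_inf Q Q ^ 3 * Theta (X\<^sub>1 * X\<^sub>2) Q / (Theta X\<^sub>1 Q * Theta X\<^sub>2 Q)) UNIV"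
    by (rule kron_has_sum[OF Q _ n1(1) _ n1(2)]) (auto simp: X\<^sub>1_def X\<^sub>2_def)
  define \<alpha> where "\<alpha> = C * (A * d + B * e + A * (B - 1) / 2 + A * B * f)"
  define \<beta> where "\<beta> = A * ((d + B * (B + 1) / 2 + B * f) * (B\<^sup>2 - A * C) + C * (A - B) / 2)"
  define P where "P = E3 Lq Lx Ly (A * ((d - C / 2) gchoose 2) + B * (d - C / 2) * (e + A / 2) + C * ((e + A / 2) gchoose 2)
      + (A * B\<^sup>2 * (f gchoose 2) + (A * (B * d + B\<^sup>2 + C * e) - A * C * (B + 1) / 2) * f)) (d - C / 2) (e + A / 2 + A * f)"
  have T1: "((\<lambda>l::int. E3 Lq Lx Ly (C * B\<^sup>2 * (of_int l * (of_int l - 1) / 2) + of_int l * \<alpha>) (of_int l * C) (of_int l * 0))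
     has_sum Theta (- E3 Lq Lx Ly \<alpha> C 0) (E3 Lq Lx Ly (C * B\<^sup>2) 0 0)) UNIV"
    by (rule theta_series_E3) (use q ABC in auto)
  have T2: "((\<lambda>l::int. E3 Lq Lx Ly (A * B\<^sup>2 * D * (of_int l * (of_int l - 1) / 2) + of_int l * \<beta>) (of_int l * (- A * C)) (of_int l * (A * B)))
     has_sum Theta (- E3 Lq Lx Ly \<beta> (- A * C) (A * B)) (E3 Lq Lx Ly (A * B\<^sup>2 * D) 0 0)) UNIV"
    by (rule theta_series_E3) (use q ABC D in auto)
  have "((\<lambda>(l\<^sub>0, j, p). P * (E3 Lq Lx Ly (C * B\<^sup>2 * (of_int l\<^sub>0 * (of_int l\<^sub>0 - 1) / 2) + of_int l\<^sub>0 * \<alpha>) (of_int l\<^sub>0 * C) (of_int l\<^sub>0 * 0) *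
      (E3 Lq Lx Ly (A * B\<^sup>2 * D * (of_int j * (of_int j - 1) / 2) + of_int j * \<beta>) (of_int j * (- A * C)) (of_int j * (A * B)) *
       kron_term X\<^sub>1 X\<^sub>2 Q p))) has_sum
     P * (Theta (- E3 Lq Lx Ly \<alpha> C 0) (E3 Lq Lx Ly (C * B\<^sup>2) 0 0) *
      (Theta (- E3 Lq Lx Ly \<beta> (- A * C) (A * B)) (E3 Lq Lx Ly (A * B\<^sup>2 * D) 0 0) *
       (qpoch_inf Q Q ^ 3 * Theta (X\<^sub>1 * X\<^sub>2) Q / (Theta X\<^sub>1 Q * Theta X\<^sub>2 Q))))) UNIV" (is "(?f has_sum ?S) UNIV")
    using has_sum_cmult_right[OF has_sum_prod_mult[OF T1 has_sum_prod_mult[OF T2 K]], of P]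
    by (simp add: case_prod_unfold)
  also have "?f = (\<lambda>(l\<^sub>0, j, m, n). let k = f' + b * j + 1 - m; l = l\<^sub>0 - a * j - n in
            - (sw (ratio a b c Lq Lx Ly (u n)) + sw (ratio c b a Lq Ly Lx (v m))) / 2 *
              theta_lattice_term a b c Lq Lx Ly ((v m + c * l, u n + a * k), (k, l)))"
  proof (intro ext, clarify)
    fix l\<^sub>0 j m n
    define k where "k = f' + b * j + 1 - m"
    define l where "l = l\<^sub>0 - a * j - n"
    have w: "kron_term X\<^sub>1 X\<^sub>2 Q (m, n) = - (sw (ratio a b c Lq Lx Ly (u n)) + sw (ratio c b a Lq Ly Lx (v m))) / 2 *
        (X\<^sub>1 powi m * X\<^sub>2 powi n * Q powi (m * n))"
      by (simp add: kron_term_def r1 r2 sw_inverse gen nz)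
    have "P * (E3 Lq Lx Ly (C * B\<^sup>2 * (of_int l\<^sub>0 * (of_int l\<^sub>0 - 1) / 2) + of_int l\<^sub>0 * \<alpha>) (of_int l\<^sub>0 * C) (of_int l\<^sub>0 * 0) *
      (E3 Lq Lx Ly (A * B\<^sup>2 * D * (of_int j * (of_int j - 1) / 2) + of_int j * \<beta>) (of_int j * (- A * C)) (of_int j * (A * B)) *
       (X\<^sub>1 powi m * X\<^sub>2 powi n * Q powi (m * n)))) = theta_lattice_term a b c Lq Lx Ly ((v m + c * l, u n + a * k), (k, l))"
      unfolding P_def X\<^sub>1_def X\<^sub>2_def Q_def E3_powi E3_mult theta_lattice_term_def hecke_term_def prod.case
    proof (rule arg_cong3[where f = "E3 Lq Lx Ly"], goal_cases)
      \<comment> \<open>Only the exponent of \<open>q\<close> is quadratic. With the values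
        \<open>d\<^sub>0\<close> of \<open>v\<close> and \<open>e\<^sub>0\<close> of
        \<open>u\<close> at index 0 as variables, it is a polynomial identity over the reals, the
        computational form of the orthogonal splitting.\<close>
      case 1
      have abc: "of_int a = A" "of_int b = B" "of_int c = C" by (simp_all add: A_def B_def C_def)
      define d\<^sub>0 where "d\<^sub>0 = real_of_int d' - of_int (c div 2)"
      define e\<^sub>0 where "e\<^sub>0 = real_of_int e' - of_int (a div 2)"
      have uv: "real_of_int (u n) = e\<^sub>0 + B * of_int n" "real_of_int (v m) = d\<^sub>0 + B * of_int m"
        by (simp_all add: u_def v_def abc d\<^sub>0_def e\<^sub>0_def)
      have kl: "real_of_int k = f + B * of_int j + 1 - of_int m" "real_of_int l = of_int l\<^sub>0 - A * of_int j - of_int n"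
        by (simp_all add: k_def l_def f_def abc)
      have de: "d = d\<^sub>0 + C / 2" "e = e\<^sub>0 + A / 2" by (simp_all add: d e d\<^sub>0_def e\<^sub>0_def)
      show ?case
        unfolding \<alpha>_def \<beta>_def gchoose_2 de D_def of_int_add of_int_mult of_int_diff of_int_choose2 of_int_power abc uv kl
        by (simp add: field_simps power2_eq_square)
    qed (simp_all add: d e A_def B_def C_def f_def u_def v_def k_def l_def field_simps)
    then show "P * (E3 Lq Lx Ly (C * B\<^sup>2 * (of_int l\<^sub>0 * (of_int l\<^sub>0 - 1) / 2) + of_int l\<^sub>0 * \<alpha>) (of_int l\<^sub>0 * C) (of_int l\<^sub>0 * 0) *
      (E3 Lq Lx Ly (A * B\<^sup>2 * D * (of_int j * (of_int j - 1) / 2) + of_int j * \<beta>) (of_int j * (- A * C)) (of_int j * (A * B)) *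
       kron_term X\<^sub>1 X\<^sub>2 Q (m, n))) = (let k = f' + b * j + 1 - m; l = l\<^sub>0 - a * j - n in
            - (sw (ratio a b c Lq Lx Ly (u n)) + sw (ratio c b a Lq Ly Lx (v m))) / 2 *
              theta_lattice_term a b c Lq Lx Ly ((v m + c * l, u n + a * k), (k, l)))"
      unfolding w k_def[symmetric] l_def[symmetric] Let_def by (simp add: mult_ac)
  qed
  also have "?S = ?R"
  proof -
    have P: "P = (cpow Lq (A * ((d - C / 2) gchoose 2) + B * (d - C / 2) * (e + A / 2) + C * ((e + A / 2) gchoose 2))
          * cpow Lx (d - C / 2) * cpow Ly (e + A / 2))
        * (cpow Lq (A * B\<^sup>2 * (f gchoose 2) + (A * (B * d + B\<^sup>2 + C * e) - A * C * (B + 1) / 2) * f) * cpow Ly (A * f))"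
      by (simp add: P_def cE E3_mult)
    have Th: "- E3 Lq Lx Ly \<alpha> C 0 = - cpow Lq (C * (A * d + B * e + A * (B - 1) / 2 + A * B * f)) * cpow Lx C"
      "- E3 Lq Lx Ly \<beta> (- A * C) (A * B) =
       - cpow Lq (A * ((d + B * (B + 1) / 2 + B * f) * (B\<^sup>2 - A * C) + C * (A - B) / 2)) * cpow Lx (- A * C) * cpow Ly (A * B)"
      "X\<^sub>1 * X\<^sub>2 = cpow Lq (D * (d + e) + A * C - B * (A + C) / 2) * cpow Lx (B - C) * cpow Ly (B - A)"
      by (simp_all add: X12 cE E3_mult \<alpha>_def \<beta>_def)
    show ?thesis
      unfolding tda P Th Q_def cpow_E3(1)[of Lq _ Lx Ly, symmetric] by (simp only: mult.assoc)
  qed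
  finally show ?thesis .
qed

text \<open>What remains is that residues and coordinates enumerate the lattice exactly once. A
  point determines \<open>s - a * k\<close> and \<open>r - c * l\<close>; after the shifts by
  \<open>a div 2\<close> and \<open>c div 2\<close>, division by \<open>b\<close> splits them into
  \<open>e'\<close>, \<open>n\<close> and \<open>d'\<close>, \<open>m\<close>. Then
  \<open>k - 1 + m\<close> splits into \<open>f'\<close> and \<open>j\<close>, and \<open>l\<close>
  determines \<open>l\<^sub>0\<close>.\<close>

lemma hecke_theta_has_sum:
  fixes a b c :: int
  assumes pos: "a > 0" "b > 0" "c > 0" "b\<^sup>2 - a * c > 0" and q: "Re Lq < 0"
    and gen: "\<And>u. norm (ratio a b c Lq Lx Ly u) \<noteq> 1" "\<And>v. norm (ratio c b a Lq Ly Lx v) \<noteq> 1"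
  shows "((\<lambda>((r, s), (k, l)). - (sw (ratio a b c Lq Lx Ly (s - a * k)) + sw (ratio c b a Lq Ly Lx (r - c * l))) / 2 *
              theta_lattice_term a b c Lq Lx Ly ((r, s), (k, l)))
      has_sum hecke_theta a b c Lq Lx Ly) UNIV" (is "(?g has_sum _) _")
proof -
  define I where "I = {0..b - 1}"
  define h where "h = (\<lambda>(d', e', f', l\<^sub>0, j, m, n). let k = f' + b * j + 1 - m; l = l\<^sub>0 - a * j - n;
      u = e' + b * n - a div 2; v = d' + b * m - c div 2 in ((v + c * l, u + a * k), (k, l)))"
  have "((\<lambda>p. ?g (h p)) has_sum hecke_theta a b c Lq Lx Ly) (I \<times> I \<times> I \<times> UNIV)"
    unfolding hecke_theta_def Let_def sum_distrib_left I_def[symmetric]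
  proof (intro has_sum_finite_Times, goal_cases)
    case (4 d' e' f')
    show ?case
    proof (rule has_sum_cong[THEN iffD1, OF _ theta_summand[OF pos q gen, where d' = d' and e' = e' and f' = f']])
      fix p :: "int \<times> int \<times> int \<times> int"
      obtain l\<^sub>0 j m n where p: "p = (l\<^sub>0, j, m, n)" by (cases p) auto
      show "(case p of (l\<^sub>0, j, m, n) \<Rightarrow> let k = f' + b * j + 1 - m; l = l\<^sub>0 - a * j - n in
            - (sw (ratio a b c Lq Lx Ly (e' + b * n - a div 2)) + sw (ratio c b a Lq Ly Lx (d' + b * m - c div 2))) / 2 *
              theta_lattice_term a b c Lq Lx Ly ((d' + b * m - c div 2 + c * l, e' + b * n - a div 2 + a * k), (k, l)))
          = ?g (h (d', e', f', p))"
        unfolding p h_def Let_def prod.case by simp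
    qed
  qed (auto simp: I_def)
  also have "?this \<longleftrightarrow> ?thesis"
  proof (rule has_sum_reindex_bij_witness[of _ "\<lambda>((r, s), (k, l)).
        let v = r - c * l + c div 2; u = s - a * k + a div 2; n = u div b; m = v div b; k' = k - 1 + m; j = k' div b in
        (v mod b, u mod b, k' mod b, l + a * j + n, j, m, n)" h], goal_cases)
    case (1 p)
    obtain d' e' f' l\<^sub>0 j m n where p: "p = (d', e', f', l\<^sub>0, j, m, n)" by (cases p) auto
    have dm: "(x + b * y) div b = y" "(x + b * y) mod b = x" if "x \<in> I" for x y
      using that pos by (auto simp: I_def)
    have I: "d' \<in> I" "e' \<in> I" "f' \<in> I" using 1 by (auto simp: p)
    have r: "x - y + z - z + y = x" "k + 1 - m - 1 + m = k" for x y z k m :: int by simp_all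
    show ?case unfolding p h_def Let_def prod.case r dm[OF I(1)] dm[OF I(2)] dm[OF I(3)] by simp
  next
    case (3 p)
    obtain r s k l where p: "p = ((r, s), (k, l))" by (cases p) auto
    have mb: "x mod b = x - b * (x div b)" for x by (simp add: minus_mult_div_eq_mod)
    show ?case unfolding p h_def Let_def prod.case mb by (simp add: algebra_simps)
  qed (use pos in \<open>auto simp: I_def Let_def\<close>)
  finally show ?thesis .
qed

section \<open>The identity away from the walls\<close>

lemma hecke_term_swap: "hecke_term c b a Lq Ly Lx s r = hecke_term a b c Lq Lx Ly r s"
  unfolding hecke_term_def E3_swap[of Lq Ly Lx] by (simp add: algebra_simps)

lemma hecke_off_walls:
  assumes pos: "a > 0" "b > 0" "c > 0" "b\<^sup>2 - a * c > 0" and q: "0 < norm q" "norm q < 1"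
    and L: "exp Lq = q" "exp Lx = - x" "exp Ly = - y"
    and gen: "\<And>u. norm (ratio a b c Lq Lx Ly u) \<noteq> 1" "\<And>v. norm (ratio c b a Lq Ly Lx v) \<noteq> 1"
  defines "D \<equiv> b\<^sup>2 - a * c"
  shows "hecke_f a b c x y q = hecke_g a b c x y (-1) (-1) q
     + 1 / (Theta (-1) (q powi (a * D)) * Theta (-1) (q powi (c * D))) * hecke_theta a b c Lq Lx Ly"
proof -
  define Qa where "Qa = q powi (a * D)"
  define Qc where "Qc = q powi (c * D)"
  have q': "Re Lq < 0" using q by (simp flip: L(1))
  have D: "D > 0" using pos by (simp add: D_def)
  have small: "0 < norm (q powi n)" "norm (q powi n) < 1" if "n > 0" for n
    using powi_less_1[OF q, of n] q that by (auto simp: norm_power_int)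
  have Qas: "0 < norm Qa" "norm Qa < 1" and Qcs: "0 < norm Qc" "norm Qc < 1"
    unfolding Qa_def Qc_def using small pos D by (auto intro!: small)
  have Tnz: "Theta (-1) Qa \<noteq> 0" "Theta (-1) Qc \<noteq> 0"
    using Theta_minus_1_nonzero Qas Qcs by auto
  have Ta: "((\<lambda>k. Qa powi choose2 k) has_sum Theta (-1) Qa) UNIV"
    using theta_series[OF Qas, of 1] by simp
  have Tc: "((\<lambda>l. Qc powi choose2 l) has_sum Theta (-1) Qc) UNIV"
    using theta_series[OF Qcs, of 1] by simp
  define G where "G = theta_lattice_term a b c Lq Lx Ly"
  have G: "G ((r, s), (k, l)) = hecke_term a b c Lq Lx Ly r s * (Qa powi choose2 k * Qc powi choose2 l)" for r s k l
    unfolding G_def theta_lattice_term_def prod.case Qa_def Qc_def D_def L(1)[symmetric]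
    by (simp add: E3_q[of Lq _ Lx Ly] E3_powi E3_mult algebra_simps)
  define S1 where "S1 = (\<Sum>t=0..a - 1. (- y) powi t * q powi (c * choose2 t) *
            Theta (q powi (b * t) * x) (q powi a) * appell_m (appell_arg a b c x y q t) (-1) Qa)"
  define S2 where "S2 = (\<Sum>t=0..c - 1. (- x) powi t * q powi (a * choose2 t) *
            Theta (q powi (b * t) * y) (q powi c) * appell_m (appell_arg c b a y x q t) (-1) Qc)"
  define w1 where "w1 = (\<lambda>u. sw (ratio a b c Lq Lx Ly u))"
  define w2 where "w2 = (\<lambda>u. sw (ratio c b a Lq Ly Lx u))"
  define g0 where "g0 = (\<lambda>((r, s), (k, l)). (sg r + sg s) / 2 * G ((r, s), (k, l)))"
  define g1 where "g1 = (\<lambda>((r, s), (k, l)). (sg s + w1 (s - a * k)) / 2 * G ((r, s), (k, l)))"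
  define g2 where "g2 = (\<lambda>((r, s), (k, l)). (sg r + w2 (r - c * l)) / 2 * G ((r, s), (k, l)))"
  define g3 where "g3 = (\<lambda>((r, s), (k, l)). - (w1 (s - a * k) + w2 (r - c * l)) / 2 * G ((r, s), (k, l)))"
  have F: "(g0 has_sum
      hecke_f a b c x y q * (Theta (-1) Qa * Theta (-1) Qc)) UNIV"
    using has_sum_prod_mult[OF hecke_f_has_sum[OF pos(1-3) q(2) L] has_sum_prod_mult[OF Ta Tc]]
    by (simp add: g0_def G sg2_def case_prod_unfold mult_ac)
  have A: "(g1 has_sum
      (Theta (-1) Qa * S1) * Theta (-1) Qc) UNIV"
  proof -
    have "((\<lambda>(((r, s), k), l). ((sg s + w1 (s - a * k)) / 2 * (hecke_term a b c Lq Lx Ly r s * Qa powi choose2 k)) * Qc powi choose2 l)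
        has_sum (Theta (-1) Qa * S1) * Theta (-1) Qc) UNIV"
      using has_sum_prod_mult[OF appell_part[OF pos q L gen(1)] Tc]
      by (simp add: w1_def S1_def Qa_def D_def case_prod_unfold)
    also have "?this \<longleftrightarrow> ?thesis"
      by (rule has_sum_reindex_bij_witness[of _ "\<lambda>((r, s), (k, l)). (((r, s), k), l)" "\<lambda>(((r, s), k), l). ((r, s), (k, l))"])
         (auto simp: g1_def G mult_ac)
    finally show ?thesis .
  qed
  have B: "(g2 has_sum
      (Theta (-1) Qc * S2) * Theta (-1) Qa) UNIV"
  proof -
    \<comment> \<open>The second half of \<open>g\<close> is the first with
      \<open>a, x, r, k\<close> exchanged for \<open>c, y, s, l\<close>; \<open>D\<close> and the
      lattice term are invariant under this exchange.\<close>
    have pos': "c > 0" "b > 0" "a > 0" "b\<^sup>2 - c * a > 0" using pos by (auto simp: mult.commute)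
    have "((\<lambda>(((s, r), l), k). ((sg r + w2 (r - c * l)) / 2 * (hecke_term c b a Lq Ly Lx s r * Qc powi choose2 l)) * Qa powi choose2 k)
        has_sum (Theta (-1) Qc * S2) * Theta (-1) Qa) UNIV"
      using has_sum_prod_mult[OF appell_part[OF pos' q L(1,3,2) gen(2)] Ta]
      by (simp add: w2_def S2_def Qc_def D_def case_prod_unfold mult.commute[of c a])
    also have "?this \<longleftrightarrow> ?thesis"
      by (rule has_sum_reindex_bij_witness[of _ "\<lambda>((r, s), (k, l)). (((s, r), l), k)" "\<lambda>(((s, r), l), k). ((r, s), (k, l))"])
         (auto simp: g2_def G hecke_term_swap[of c b a] mult_ac)
    finally show ?thesis .
  qed
  have T: "(g3 has_sum hecke_theta a b c Lq Lx Ly) UNIV"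
    using hecke_theta_has_sum[OF pos q' gen] by (simp only: g3_def w1_def w2_def G_def)
  have "g0 p - g1 p - g2 p - g3 p = 0" for p
  proof -
    obtain r s k l where p: "p = ((r, s), (k, l))" by (cases p) auto
    have cancel: "(x + y) / 2 * z - (y + w) / 2 * z - (x + w') / 2 * z - (- (w + w') / 2 * z) = 0" for x y w w' z :: complex
      by (simp add: field_simps)
    show ?thesis unfolding p g0_def g1_def g2_def g3_def prod.case by (rule cancel)
  qed
  then have "((\<lambda>p. 0) has_sum (hecke_f a b c x y q * (Theta (-1) Qa * Theta (-1) Qc)
       - (Theta (-1) Qa * S1) * Theta (-1) Qc - (Theta (-1) Qc * S2) * Theta (-1) Qa - hecke_theta a b c Lq Lx Ly)) (UNIV :: ((int \<times> int) \<times> int \<times> int) set)"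
    using has_sum_minus[OF has_sum_minus[OF has_sum_minus[OF F A] B] T] by (simp only:)
  then have E: "hecke_f a b c x y q * (Theta (-1) Qa * Theta (-1) Qc)
       - (Theta (-1) Qa * S1) * Theta (-1) Qc - (Theta (-1) Qc * S2) * Theta (-1) Qa - hecke_theta a b c Lq Lx Ly = 0"
    using has_sum_0_simp by (rule has_sum_unique)
  have solve: "f = S + S' + 1 / (A * B) * T"
    if "A \<noteq> 0" "B \<noteq> 0" "f * (A * B) - (A * S) * B - (B * S') * A - T = 0" for A B f S S' T :: complex
  proof -
    have "f * (A * B) = (S + S' + 1 / (A * B) * T) * (A * B)" using that by (simp add: distrib_right) algebra
    then show ?thesis using that(1,2) by simp
  qed
  have "hecke_f a b c x y q = S1 + S2 + 1 / (Theta (-1) Qa * Theta (-1) Qc) * hecke_theta a b c Lq Lx Ly"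
    by (rule solve[OF Tnz E])
  then show ?thesis
    by (simp add: hecke_g_def Let_def S1_def S2_def Qa_def Qc_def D_def)
qed

section \<open>Continuity and removal of the walls\<close>

text \<open>The excluded \<open>\<epsilon>\<close> form an arithmetic progression, so 0 has a
  punctured neighbourhood free of them even when 0 itself belongs to the progression.\<close>

lemma eventually_avoid_lattice:
  fixes \<alpha> \<beta> \<kappa> :: real
  assumes "\<alpha> > 0" "\<kappa> \<noteq> 0"
  shows "\<forall>\<^sub>F \<epsilon> in at 0. \<forall>u::int. \<alpha> * u + \<beta> + \<kappa> * \<epsilon> \<noteq> 0"
proof -
  define \<theta> where "\<theta> = \<beta> / \<alpha>"
  \<comment> \<open>The distance from \<open>\<theta>\<close> to the nearest integer other than
    \<open>\<theta>\<close> itself.\<close>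
  define \<delta> where "\<delta> = (if \<theta> \<in> \<int> then 1 else min (frac \<theta>) (1 - frac \<theta>))"
  have "\<delta> > 0" using frac_lt_1[of \<theta>] frac_gt_0_iff[of \<theta>] by (auto simp: \<delta>_def)
  show ?thesis
    unfolding eventually_at
  proof (intro exI[of _ "\<delta> * \<alpha> / \<bar>\<kappa>\<bar>"] conjI ballI impI allI)
    show "\<delta> * \<alpha> / \<bar>\<kappa>\<bar> > 0" using assms \<open>\<delta> > 0\<close> by simp
    fix \<epsilon> :: real and u :: int
    assume "\<epsilon> \<noteq> 0 \<and> dist \<epsilon> 0 < \<delta> * \<alpha> / \<bar>\<kappa>\<bar>"
    then have e: "\<epsilon> \<noteq> 0" "\<bar>\<epsilon>\<bar> < \<delta> * \<alpha> / \<bar>\<kappa>\<bar>" by auto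
    define \<eta> where "\<eta> = \<kappa> * \<epsilon> / \<alpha>"
    have \<eta>: "\<eta> \<noteq> 0" "\<bar>\<eta>\<bar> < \<delta>"
      using e assms by (auto simp: \<eta>_def abs_mult field_simps)
    show "\<alpha> * u + \<beta> + \<kappa> * \<epsilon> \<noteq> 0"
    proof
      assume "\<alpha> * u + \<beta> + \<kappa> * \<epsilon> = 0"
      then have n: "\<theta> + \<eta> = of_int (- u)" using assms by (simp add: \<theta>_def \<eta>_def field_simps)
      show False
      proof (cases "\<theta> \<in> \<int>")
        case True
        then obtain m where "\<theta> = of_int m" by (auto elim: Ints_cases)
        then have "\<eta> = of_int (- u - m)" using n by simp
        then have "\<bar>real_of_int (- u - m)\<bar> < 1" "- u - m \<noteq> 0" using \<eta> True by (auto simp: \<delta>_def)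
        then show False by linarith
      next
        case False
        then have "\<bar>\<eta>\<bar> < frac \<theta>" "\<bar>\<eta>\<bar> < 1 - frac \<theta>" using \<eta> by (auto simp: \<delta>_def)
        then have "of_int \<lfloor>\<theta>\<rfloor> < \<theta> + \<eta>" "\<theta> + \<eta> < of_int \<lfloor>\<theta>\<rfloor> + 1" by (auto simp: frac_def)
        then have "\<lfloor>\<theta>\<rfloor> < - u" "- u < \<lfloor>\<theta>\<rfloor> + 1" unfolding n by linarith+
        then show False by linarith
      qed
    qed
  qed
qed

text \<open>For large positive or negative \<open>k\<close> the point \<open>Q powi k * A\<close> is
  close to 0 or far out, uniformly for \<open>A\<close> near \<open>A\<^sub>0\<close>; the finitely
  many other \<open>k\<close> are handled by continuity. In contrast to the lattice expansion, this
  asks only that \<open>Q powi k * A\<^sub>0\<close> avoid the value 1, not the modulus 1.\<close>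

lemma lerch_denominators_bounded:
  fixes Q A\<^sub>0 :: complex
  assumes Q: "0 < norm Q" "norm Q < 1" and A: "A\<^sub>0 \<noteq> 0" "\<And>k. Q powi k * A\<^sub>0 \<noteq> 1"
  obtains B where "\<forall>\<^sub>F A in at A\<^sub>0. \<forall>k. norm (1 / (1 - Q powi k * A)) \<le> B"
proof -
  have lim: "(\<lambda>n. norm Q ^ n) \<longlonglongrightarrow> 0" using Q by (intro LIMSEQ_power_zero) auto
  have "\<forall>\<^sub>F n in sequentially. norm Q ^ n < 1 / (4 * norm A\<^sub>0) \<and> norm Q ^ n < norm A\<^sub>0 / 4"
    by (intro eventually_conj order_tendstoD[OF lim]) (use A in auto)
  \<comment> \<open>The constants leave room for \<open>A\<close> with norm between
    \<open>norm A\<^sub>0 / 2\<close> and \<open>2 * norm A\<^sub>0\<close>: then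
    \<open>Q powi k * A\<close> has norm at most 1/2 for \<open>k > K\<close> and above 2 for
    \<open>k < - K\<close>.\<close>
  then obtain K where K: "norm Q ^ K < 1 / (4 * norm A\<^sub>0)" "norm Q ^ K < norm A\<^sub>0 / 4"
    by (auto simp: eventually_sequentially)
  define I where "I = {- int K..int K}"
  define B where "B = 2 + (\<Sum>k\<in>I. 2 / norm (1 - Q powi k * A\<^sub>0))"
  have B2: "2 \<le> B" unfolding B_def by (simp add: sum_nonneg)
  have Bk: "2 / norm (1 - Q powi k * A\<^sub>0) \<le> B" if "k \<in> I" for k
  proof -
    have "2 / norm (1 - Q powi k * A\<^sub>0) \<le> (\<Sum>k\<in>I. 2 / norm (1 - Q powi k * A\<^sub>0))"
      by (rule member_le_sum[OF that]) (auto simp: I_def)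
    then show ?thesis by (simp add: B_def)
  qed
  have "\<forall>\<^sub>F A in at A\<^sub>0. \<forall>k\<in>I. norm (1 - Q powi k * A) > norm (1 - Q powi k * A\<^sub>0) / 2"
  proof (rule eventually_ball_finite)
    show "finite I" by (simp add: I_def)
    show "\<forall>k\<in>I. \<forall>\<^sub>F A in at A\<^sub>0. norm (1 - Q powi k * A) > norm (1 - Q powi k * A\<^sub>0) / 2"
    proof
      fix k
      have "((\<lambda>A. norm (1 - Q powi k * A)) \<longlongrightarrow> norm (1 - Q powi k * A\<^sub>0)) (at A\<^sub>0)"
        by (intro tendsto_intros)
      then show "\<forall>\<^sub>F A in at A\<^sub>0. norm (1 - Q powi k * A) > norm (1 - Q powi k * A\<^sub>0) / 2"
        by (rule order_tendstoD) (use A(2)[of k] in simp)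
    qed
  qed
  moreover have "\<forall>\<^sub>F A in at A\<^sub>0. norm A < 2 * norm A\<^sub>0" "\<forall>\<^sub>F A in at A\<^sub>0. norm A > norm A\<^sub>0 / 2"
    by (rule order_tendstoD[OF tendsto_norm[OF tendsto_ident_at]], use A in simp)+
  ultimately have "\<forall>\<^sub>F A in at A\<^sub>0. \<forall>k. norm (1 / (1 - Q powi k * A)) \<le> B"
  proof eventually_elim
    case (elim A)
    show ?case
    proof
      fix k
      consider "k \<in> I" | "k > int K" | "k < - int K" by (force simp: I_def)
      then show "norm (1 / (1 - Q powi k * A)) \<le> B"
      proof cases
        case 1
        have "norm (1 / (1 - Q powi k * A)) = 1 / norm (1 - Q powi k * A)" by (simp add: norm_divide)
        also have "\<dots> \<le> 1 / (norm (1 - Q powi k * A\<^sub>0) / 2)"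
          using elim(1) 1 A(2)[of k] by (intro divide_left_mono mult_pos_pos) (auto simp: less_imp_le intro: le_less_trans[OF _ bspec[OF elim(1) 1]])
        also have "\<dots> \<le> B" using Bk[OF 1] by simp
        finally show ?thesis .
      next
        case 2
        have "norm Q powi k \<le> norm Q ^ K"
          using power_int_decreasing[of "int K" k "norm Q"] Q 2 by auto
        then have "norm (Q powi k * A) \<le> norm Q ^ K * (2 * norm A\<^sub>0)"
          unfolding norm_mult norm_power_int using elim by (intro mult_mono) auto
        also have "\<dots> \<le> 1 / (4 * norm A\<^sub>0) * (2 * norm A\<^sub>0)"
          using K by (intro mult_right_mono) auto
        also have "\<dots> = 1 / 2" using A by simp
        finally have "1 / 2 \<le> norm (1 - Q powi k * A)"
          using norm_triangle_ineq2[of 1 "Q powi k * A"] by simp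
        then have "1 / norm (1 - Q powi k * A) \<le> 1 / (1 / 2)" by (intro divide_left_mono mult_pos_pos) auto
        then show ?thesis using B2 by (simp add: norm_divide)
      next
        case 3
        have "norm Q powi (- k) \<le> norm Q ^ K"
          using power_int_decreasing[of "int K" "- k" "norm Q"] Q 3 by auto
        then have "norm Q powi (- k) < norm A\<^sub>0 / 4" using K by linarith
        then have "norm A\<^sub>0 / 4 * norm Q powi k > 1"
          using Q by (simp add: power_int_minus field_simps)
        then have "2 < norm A\<^sub>0 / 2 * norm Q powi k" by simp
        also have "\<dots> \<le> norm (Q powi k * A)"
          unfolding norm_mult norm_power_int using elim by (subst mult.commute, intro mult_left_mono) auto
        finally have "1 \<le> norm (1 - Q powi k * A)"
          using norm_triangle_ineq2[of "Q powi k * A" 1] by (simp add: norm_minus_commute)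
        then have "1 / norm (1 - Q powi k * A) \<le> 1 / 1" by (intro divide_left_mono mult_pos_pos) auto
        then show ?thesis using B2 by (simp add: norm_divide)
      qed
    qed
  qed
  then show ?thesis by (rule that)
qed

lemma isCont_appell_m:
  fixes Q A\<^sub>0 :: complex
  assumes Q: "0 < norm Q" "norm Q < 1" and A: "A\<^sub>0 \<noteq> 0" "\<And>k. 1 - Q powi (k - 1) * A\<^sub>0 * (-1) \<noteq> 0"
  shows "isCont (\<lambda>A. appell_m A (-1) Q) A\<^sub>0"
proof -
  have Q0: "Q \<noteq> 0" using Q by auto
  have d: "1 - Q powi k * (- A\<^sub>0) \<noteq> 0" for k
    using A(2)[of "k + 1"] by simp
  have ne: "Q powi k * (- A\<^sub>0) \<noteq> 1" for k
  proof
    assume "Q powi k * (- A\<^sub>0) = 1"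
    then show False using d[of k] by (simp only: diff_self)
  qed
  obtain B where B: "\<forall>\<^sub>F A in at (- A\<^sub>0). \<forall>k. norm (1 / (1 - Q powi k * A)) \<le> B"
    by (rule lerch_denominators_bounded[OF Q _ ne]) (use A(1) in auto)
  have "filterlim uminus (at (- A\<^sub>0)) (at A\<^sub>0)"
    unfolding filterlim_at
  proof
    show "\<forall>\<^sub>F A in at A\<^sub>0. - A \<in> UNIV \<and> - A \<noteq> - A\<^sub>0"
      using eventually_neq_at_within[of A\<^sub>0] by eventually_elim simp
  qed (intro tendsto_intros)
  from eventually_compose_filterlim[OF B this]
  have B': "\<forall>\<^sub>F A in at A\<^sub>0. \<forall>k. norm (1 / (1 - Q powi k * (- A))) \<le> B" .
  have "((\<lambda>A. \<Sum>\<^sub>\<infinity>k. Q powi choose2 k / (1 - Q powi (k - 1) * (- A))) \<longlongrightarrow>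
      (\<Sum>\<^sub>\<infinity>k. Q powi choose2 k / (1 - Q powi (k - 1) * (- A\<^sub>0)))) (at A\<^sub>0)"
  proof (rule tendsto_infsum_dominated)
    show "\<forall>\<^sub>F A in at A\<^sub>0. \<forall>k\<in>UNIV. norm (Q powi choose2 k / (1 - Q powi (k - 1) * (- A))) \<le> norm (Q powi choose2 k) * B"
      using B'
    proof eventually_elim
      case (elim A)
      show ?case
      proof
        fix k
        show "norm (Q powi choose2 k / (1 - Q powi (k - 1) * (- A))) \<le> norm (Q powi choose2 k) * B"
          using mult_left_mono[OF elim[rule_format, of "k - 1"], of "norm (Q powi choose2 k)"]
          by (simp add: norm_divide)
      qed
    qed
    show "(\<lambda>k. norm (Q powi choose2 k) * B) summable_on UNIV"
      using theta_summable[OF Q, of 1]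
      by (intro summable_on_cmult_left) (simp add: summable_on_iff_abs_summable_on_complex)
    show "((\<lambda>A. Q powi choose2 k / (1 - Q powi (k - 1) * - A)) \<longlongrightarrow> Q powi choose2 k / (1 - Q powi (k - 1) * - A\<^sub>0)) (at A\<^sub>0)" for k
      by (intro tendsto_intros d)
  qed simp
  then show ?thesis
    unfolding isCont_def appell_m_minus_1 by (intro tendsto_mult tendsto_const)
qed

lemma tendsto_Theta:
  assumes "(f \<longlongrightarrow> l) F" "l \<noteq> 0" "norm q < 1"
  shows "((\<lambda>x. Theta (f x) q) \<longlongrightarrow> Theta l q) F"
  by (rule isCont_tendsto_compose[OF isCont_Theta assms(1)]) (use assms in auto)

lemma cpow_nonzero [simp]: "cpow L s \<noteq> 0"
  by (simp add: cpow_def)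

lemma norm_cpow_less_1: "Re L < 0 \<Longrightarrow> s > 0 \<Longrightarrow> norm (cpow L s) < 1"
  by (simp add: cpow_def mult_pos_neg)

lemma cpow_of_int: "cpow L (of_int n) = exp L powi n"
  by (simp add: cpow_def exp_power_int)

text \<open>A real perturbation changes the norm of a term by \<open>exp (r * \<epsilon>)\<close>,
  which is at most \<open>exp r + exp (- r)\<close> for
  \<open>\<bar>\<epsilon>\<bar> \<le> 1\<close>. The majorants at \<open>Lx + 1\<close> and
  \<open>Lx - 1\<close> together therefore dominate all small perturbations.\<close>

lemma hecke_f_tendsto:
  assumes pos: "a > 0" "b > 0" "c > 0" and q: "norm q < 1"
    and L: "exp Lq = q" "exp Lx = - x" "exp Ly = - y"
  shows "((\<lambda>\<epsilon>::real. hecke_f a b c (x * exp (of_real \<epsilon>)) y q) \<longlongrightarrow> hecke_f a b c x y q) (at 0)"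
proof -
  have q': "Re Lq < 0" using q by (simp flip: L(1))
  define M where "M = (\<lambda>\<sigma>::complex. \<lambda>(r, s). norm (E3 Lq (Lx + \<sigma>) Ly (of_int (a * choose2 r)) (of_int r) 0) *
       norm (E3 Lq Lx Ly (of_int (c * choose2 s)) 0 (of_int s)))"
  have bd: "norm (E3 Lq (Lx + of_real \<epsilon>) Ly \<alpha> \<beta> 0) \<le>
      norm (E3 Lq (Lx + 1) Ly \<alpha> \<beta> 0) + norm (E3 Lq (Lx + (-1)) Ly \<alpha> \<beta> 0)" if "\<bar>\<epsilon>\<bar> \<le> 1" for \<epsilon> \<alpha> \<beta>
  proof -
    have "\<beta> * \<epsilon> \<le> \<bar>\<beta>\<bar>" using that by (metis abs_ge_self abs_mult mult_left_le order_trans abs_ge_zero)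
    then have "\<beta> * \<epsilon> \<le> \<beta> \<or> \<beta> * \<epsilon> \<le> - \<beta>" by linarith
    then show ?thesis
    proof
      assume "\<beta> * \<epsilon> \<le> \<beta>"
      then have "norm (E3 Lq (Lx + of_real \<epsilon>) Ly \<alpha> \<beta> 0) \<le> norm (E3 Lq (Lx + 1) Ly \<alpha> \<beta> 0)"
        by (simp add: norm_E3 distrib_left)
      then show ?thesis by (simp add: add_increasing2)
    next
      assume "\<beta> * \<epsilon> \<le> - \<beta>"
      then have "norm (E3 Lq (Lx + of_real \<epsilon>) Ly \<alpha> \<beta> 0) \<le> norm (E3 Lq (Lx + (-1)) Ly \<alpha> \<beta> 0)"
        by (simp add: norm_E3 algebra_simps)
      then show ?thesis by (simp add: add_increasing)
    qed
  qed
  have "((\<lambda>\<epsilon>::real. \<Sum>\<^sub>\<infinity>(r, s). sg2 r s * hecke_term a b c Lq (Lx + of_real \<epsilon>) Ly r s) \<longlongrightarrow>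
      (\<Sum>\<^sub>\<infinity>(r, s). sg2 r s * hecke_term a b c Lq Lx Ly r s)) (at 0)"
  proof (rule tendsto_infsum_dominated)
    have Mb: "norm (sg2 r s * hecke_term a b c Lq (Lx + of_real \<epsilon>) Ly r s) \<le> M 1 (r, s) + M (-1) (r, s)"
      if "\<bar>\<epsilon>\<bar> \<le> 1" for \<epsilon> r s
    proof -
      have "norm (sg2 r s * hecke_term a b c Lq (Lx + of_real \<epsilon>) Ly r s) \<le>
         norm (E3 Lq (Lx + of_real \<epsilon>) Ly (of_int (a * choose2 r)) (of_int r) 0) *
         norm (E3 Lq (Lx + of_real \<epsilon>) Ly (of_int (c * choose2 s)) 0 (of_int s))"
        by (rule hecke_f_summable_bound[OF pos q'])
      also have "E3 Lq (Lx + of_real \<epsilon>) Ly (of_int (c * choose2 s)) 0 (of_int s) = E3 Lq Lx Ly (of_int (c * choose2 s)) 0 (of_int s)"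
        by (simp add: E3_def)
      also have "norm (E3 Lq (Lx + of_real \<epsilon>) Ly (of_int (a * choose2 r)) (of_int r) 0) *
         norm (E3 Lq Lx Ly (of_int (c * choose2 s)) 0 (of_int s)) \<le> M 1 (r, s) + M (-1) (r, s)"
        unfolding M_def prod.case distrib_right[symmetric] by (intro mult_right_mono bd that) simp
      finally show ?thesis .
    qed
    have "\<forall>\<^sub>F \<epsilon>::real in at 0. \<bar>\<epsilon>\<bar> \<le> 1"
      unfolding eventually_at by (intro exI[of _ 1]) auto
    then show "\<forall>\<^sub>F \<epsilon> in at 0. \<forall>p\<in>UNIV. norm (case p of (r, s) \<Rightarrow> sg2 r s * hecke_term a b c Lq (Lx + of_real \<epsilon>) Ly r s) \<le> M 1 p + M (-1) p"
      by eventually_elim (use Mb in auto)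
    have "M \<sigma> summable_on UNIV" for \<sigma>
      using hecke_bound_summable[OF pos(1,3) q', of "Lx + \<sigma>" Ly]
      by (simp add: M_def E3_def)
    then show "(\<lambda>p. M 1 p + M (-1) p) summable_on UNIV" by (intro summable_on_add)
    show "((\<lambda>\<epsilon>::real. case p of (r, s) \<Rightarrow> sg2 r s * hecke_term a b c Lq (Lx + of_real \<epsilon>) Ly r s) \<longlongrightarrow>
        (case p of (r, s) \<Rightarrow> sg2 r s * hecke_term a b c Lq Lx Ly r s)) (at 0)" for p
      unfolding hecke_term_def E3_def case_prod_unfold
      by (rule tendsto_eq_intros refl | simp)+
  qed simp
  moreover have "hecke_f a b c (x * exp (of_real \<epsilon>)) y q = (\<Sum>\<^sub>\<infinity>(r, s). sg2 r s * hecke_term a b c Lq (Lx + of_real \<epsilon>) Ly r s)" for \<epsilon> :: real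
    by (rule hecke_f_eq) (use L in \<open>auto simp: exp_add\<close>)
  moreover have "hecke_f a b c x y q = (\<Sum>\<^sub>\<infinity>(r, s). sg2 r s * hecke_term a b c Lq Lx Ly r s)"
    by (rule hecke_f_eq[OF L])
  ultimately show ?thesis by simp
qed

lemma hecke_g_tendsto:
  assumes pos: "a > 0" "b > 0" "c > 0" and D: "D = b\<^sup>2 - a * c" "D > 0" and q: "0 < norm q" "norm q < 1"
    and xy: "x \<noteq> 0" "y \<noteq> 0"
    and gen: "generic a b c x y q Lq Lx Ly"
    and X: "(X \<longlongrightarrow> x) F"
  shows "((\<lambda>\<epsilon>. hecke_g a b c (X \<epsilon>) y (-1) (-1) q) \<longlongrightarrow> hecke_g a b c x y (-1) (-1) q) F"
proof -
  have q0: "q \<noteq> 0" using q by auto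
  have small: "0 < norm (q powi n)" "norm (q powi n) < 1" if "n > 0" for n
    using powi_less_1[OF q, of n] q that by (auto simp: norm_power_int)
  have m1: "((\<lambda>\<epsilon>. appell_m (appell_arg a b c (X \<epsilon>) y q t) (-1) (q powi (a * D))) \<longlongrightarrow>
      appell_m (appell_arg a b c x y q t) (-1) (q powi (a * D))) F" if "t \<in> {0..a - 1}" for t
  proof (rule isCont_tendsto_compose[OF isCont_appell_m])
    show "((\<lambda>\<epsilon>. appell_arg a b c (X \<epsilon>) y q t) \<longlongrightarrow> appell_arg a b c x y q t) F"
      unfolding appell_arg_def by (intro tendsto_intros X) (use xy in auto)
    show "appell_arg a b c x y q t \<noteq> 0" using xy q0 by (simp add: appell_arg_def)
    show "1 - (q powi (a * D)) powi (k - 1) * appell_arg a b c x y q t * (-1) \<noteq> 0" for k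
      using gen that unfolding generic_def Let_def D(1) by blast
  qed (use small[of "a * D"] pos D in auto)
  have m2: "((\<lambda>\<epsilon>. appell_m (appell_arg c b a y (X \<epsilon>) q t) (-1) (q powi (c * D))) \<longlongrightarrow>
      appell_m (appell_arg c b a y x q t) (-1) (q powi (c * D))) F" if "t \<in> {0..c - 1}" for t
  proof (rule isCont_tendsto_compose[OF isCont_appell_m])
    show "((\<lambda>\<epsilon>. appell_arg c b a y (X \<epsilon>) q t) \<longlongrightarrow> appell_arg c b a y x q t) F"
      unfolding appell_arg_def by (intro tendsto_intros X) (use xy in auto)
    show "appell_arg c b a y x q t \<noteq> 0" using xy q0 by (simp add: appell_arg_def)
    show "1 - (q powi (c * D)) powi (k - 1) * appell_arg c b a y x q t * (-1) \<noteq> 0" for k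
      using gen that unfolding generic_def Let_def D(1) by blast
  qed (use small[of "c * D"] pos D in auto)
  show ?thesis
    unfolding hecke_g_def Let_def D(1)[symmetric]
    by (intro tendsto_intros m1 m2 tendsto_Theta X) (use xy q0 small pos in auto)
qed

text \<open>Moving the logarithm \<open>Lx\<close> instead of \<open>x\<close> keeps the branch of
  the fractional powers, so every factor varies continuously; genericity keeps the theta
  denominators nonzero at the limit.\<close>

lemma hecke_theta_tendsto:
  assumes pos: "a > 0" "b > 0" "c > 0" and D: "D = b\<^sup>2 - a * c" "D > 0" and q: "norm q < 1"
    and L: "exp Lq = q"
    and gen: "generic a b c x y q Lq Lx Ly"
    and M: "(M \<longlongrightarrow> Lx) F"
  shows "((\<lambda>\<epsilon>. hecke_theta a b c Lq (M \<epsilon>) Ly) \<longlongrightarrow> hecke_theta a b c Lq Lx Ly) F"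
proof -
  have q': "Re Lq < 0" using q by (simp flip: L(1))
  define A B C where "A = real_of_int a" and "B = real_of_int b" and "C = real_of_int c"
  have ABC: "A > 0" "B > 0" "C > 0" using pos by (auto simp: A_def B_def C_def)
  have DE: "B\<^sup>2 - A * C = real_of_int D" by (simp add: A_def B_def C_def D)
  have base: "cpow Lq (B * (B\<^sup>2 - A * C)) = q powi (b * D)"
    unfolding DE using cpow_of_int[of Lq "b * D"] by (simp add: B_def L)
  have cp: "((\<lambda>\<epsilon>. cpow (M \<epsilon>) s) \<longlongrightarrow> cpow Lx s) F" for s
    unfolding cpow_def by (intro tendsto_intros M)
  have n1: "Theta (theta_den_arg A B C Lq Lx Ly (of_int e + frac (A / 2))) (cpow Lq (B * (B\<^sup>2 - A * C))) \<noteq> 0"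
    if "e \<in> {0..b - 1}" for e :: int
    using gen that unfolding base unfolding generic_def Let_def A_def B_def C_def D(1) by blast
  have n2: "Theta (theta_den_arg C B A Lq Ly Lx (of_int d + frac (C / 2))) (cpow Lq (B * (B\<^sup>2 - A * C))) \<noteq> 0"
    if "d \<in> {0..b - 1}" for d :: int
    using gen that unfolding base unfolding generic_def Let_def A_def B_def C_def D(1) by blast
  have t1: "((\<lambda>\<epsilon>. theta_den_arg A B C Lq (M \<epsilon>) Ly e) \<longlongrightarrow> theta_den_arg A B C Lq Lx Ly e) F"
    "((\<lambda>\<epsilon>. theta_den_arg C B A Lq Ly (M \<epsilon>) e) \<longlongrightarrow> theta_den_arg C B A Lq Ly Lx e) F" for e
    unfolding theta_den_arg_def by (intro tendsto_intros cp)+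
  have nz: "theta_den_arg A B C Lq Lx Ly e \<noteq> 0" "theta_den_arg C B A Lq Ly Lx e \<noteq> 0" for e
    by (simp_all add: theta_den_arg_def)
  have D0: "B\<^sup>2 - A * C > 0" unfolding DE using D(2) by simp
  have s: "norm (cpow Lq (B * (B\<^sup>2 - A * C))) < 1" "norm (cpow Lq (C * B\<^sup>2)) < 1"
    "norm (cpow Lq (A * B\<^sup>2 * (B\<^sup>2 - A * C))) < 1"
    by (intro norm_cpow_less_1 q' mult_pos_pos zero_less_power ABC D0)+
  show ?thesis
    unfolding hecke_theta_def Let_def A_def[symmetric] B_def[symmetric] C_def[symmetric]
    by (intro tendsto_sum tendsto_mult tendsto_divide tendsto_const tendsto_minus tendsto_Theta cp t1 s nz)
       (use n1 n2 in auto)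
qed

text \<open>Exposes the logarithm of the modulus as an affine function of \<open>u\<close> and of
  \<open>Re Lx\<close>, the form in which the walls become arithmetic progressions.\<close>

lemma norm_ratio:
  assumes "D = b\<^sup>2 - a * c"
  shows "norm (ratio a b c Lq Lx Ly u) =
     exp (- (of_int D * Re Lq) * of_int u + ((of_int a * (of_int b - of_int c) - of_int a * of_int D) / 2 * Re Lq
       - of_int b * Re Lx + of_int a * Re Ly))"
  unfolding ratio_def Let_def norm_E3 assms
  by (rule arg_cong[where f = exp]) (simp add: field_simps)

theorem theorem4p2:
  fixes a b c D :: int and q x y Lq Lx Ly :: complex
  assumes "a > 0" and "b > 0" and "c > 0"
    and "D = b\<^sup>2 - a * c" and "D > 0"
    and "0 < norm q" and "norm q < 1"
    and "x \<noteq> 0" and "y \<noteq> 0"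
    and "exp Lq = q" and "exp Lx = - x" and "exp Ly = - y"
    and "generic a b c x y q Lq Lx Ly"
  shows "hecke_f a b c x y q =
           hecke_g a b c x y (-1) (-1) q
           + 1 / (Theta (-1) (q powi (a * D)) * Theta (-1) (q powi (c * D)))
             * hecke_theta a b c Lq Lx Ly"
proof -
  define X where "X = (\<lambda>\<epsilon>::real. x * exp (of_real \<epsilon>))"
  define M where "M = (\<lambda>\<epsilon>::real. Lx + of_real \<epsilon>)"
  define K where "K = 1 / (Theta (-1) (q powi (a * D)) * Theta (-1) (q powi (c * D)))"
  have q': "Re Lq < 0" using assms(7) by (simp flip: assms(10))
  have D: "real_of_int D = (of_int b)\<^sup>2 - of_int a * of_int c" by (simp add: assms(4))
  have X: "(X \<longlongrightarrow> x) (at 0)" unfolding X_def by (rule tendsto_eq_intros refl | simp)+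
  have M: "(M \<longlongrightarrow> Lx) (at 0)" unfolding M_def by (rule tendsto_eq_intros refl | simp)+
  have \<alpha>: "- (of_int D * Re Lq) > 0" using assms(5) q' by (simp add: mult_pos_neg)
  \<comment> \<open>These are the coefficients of \<open>Re Lx\<close> in the logarithmic moduli of
    the two ratios. Both are nonzero, so perturbing \<open>Lx\<close> alone leaves both families of
    walls.\<close>
  have \<kappa>: "- real_of_int b \<noteq> 0" "real_of_int c \<noteq> 0" using assms(2,3) by auto
  define \<beta> where "\<beta> = (\<lambda>(a :: int) (c :: int) Lx Ly.
      (of_int a * (of_int b - of_int c) - of_int a * of_int D) / 2 * Re Lq - of_int b * Re Lx + of_int a * Re Ly)"
  have "norm (ratio a b c Lq (M \<epsilon>) Ly u) = exp (- (of_int D * Re Lq) * of_int u + \<beta> a c Lx Ly + (- of_int b) * \<epsilon>)" for \<epsilon> u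
    unfolding norm_ratio[OF assms(4)] M_def \<beta>_def by (simp add: algebra_simps)
  then have "\<forall>\<^sub>F \<epsilon> in at 0. \<forall>u. norm (ratio a b c Lq (M \<epsilon>) Ly u) \<noteq> 1"
    using eventually_avoid_lattice[OF \<alpha> \<kappa>(1), of "\<beta> a c Lx Ly"] by (simp only: exp_eq_one_iff)
  moreover have "norm (ratio c b a Lq Ly (M \<epsilon>) u) = exp (- (of_int D * Re Lq) * of_int u + \<beta> c a Ly Lx + of_int c * \<epsilon>)" for \<epsilon> u
  proof -
    have "D = b\<^sup>2 - c * a" using assms(4) by simp
    then show ?thesis unfolding norm_ratio[OF \<open>D = b\<^sup>2 - c * a\<close>] M_def \<beta>_def by (simp add: algebra_simps)
  qed
  then have "\<forall>\<^sub>F \<epsilon> in at 0. \<forall>u. norm (ratio c b a Lq Ly (M \<epsilon>) u) \<noteq> 1"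
    using eventually_avoid_lattice[OF \<alpha> \<kappa>(2), of "\<beta> c a Ly Lx"] by (simp only: exp_eq_one_iff)
  ultimately have "\<forall>\<^sub>F \<epsilon> in at 0. hecke_g a b c (X \<epsilon>) y (-1) (-1) q + K * hecke_theta a b c Lq (M \<epsilon>) Ly = hecke_f a b c (X \<epsilon>) y q"
  proof eventually_elim
    case (elim \<epsilon>)
    have D: "b\<^sup>2 - a * c > 0" using assms(4,5) by simp
    have "exp (M \<epsilon>) = - X \<epsilon>" by (simp add: M_def X_def exp_add assms(11))
    from hecke_off_walls[OF assms(1-3) D assms(6,7,10) this assms(12)] show ?case
      unfolding K_def assms(4) using elim by simp
  qed
  moreover have "((\<lambda>\<epsilon>. hecke_g a b c (X \<epsilon>) y (-1) (-1) q + K * hecke_theta a b c Lq (M \<epsilon>) Ly) \<longlongrightarrow>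
      hecke_g a b c x y (-1) (-1) q + K * hecke_theta a b c Lq Lx Ly) (at 0)"
    by (intro tendsto_add tendsto_mult tendsto_const hecke_g_tendsto[OF assms(1-9,13) X]
          hecke_theta_tendsto[OF assms(1-5,7,10,13) M])
  ultimately have "((\<lambda>\<epsilon>. hecke_f a b c (X \<epsilon>) y q) \<longlongrightarrow> hecke_g a b c x y (-1) (-1) q + K * hecke_theta a b c Lq Lx Ly) (at 0)"
    by (rule Lim_transform_eventually[rotated])
  moreover have "((\<lambda>\<epsilon>. hecke_f a b c (X \<epsilon>) y q) \<longlongrightarrow> hecke_f a b c x y q) (at 0)"
    unfolding X_def by (rule hecke_f_tendsto[OF assms(1-3,7,10-12)])
  ultimately show ?thesis unfolding K_def using tendsto_unique[OF trivial_limit_at] by blast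
qed

end
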